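(* The ILP consistency problem for the setting $\mathcal{G}$ is NP-hard. The problem remains NP-hard even when the hypothesis language and the example languages are additionally restricted to clauses having any combination of the following properties: (i) being Horn clauses; (ii) all literals have arity at most 2; (iii) the hypothesis contains at most 2 distinct variables; (iv) no term is repeated within a single literal.
   Context: Clauses are finite disjunctions of first-order literals, treated as sets of literals (no duplicate literals). A clause $\phi$ $\theta$-subsumes a clause $\psi$, written $\phi \vdash \psi$, if there is a variable substitution $\theta$ with $\phi\theta \subseteq \psi$. For a set $E$ of clauses, $H \vdash E$ means $H \vdash e$ for every $e \in E$, and $H \not\vdash E$ means $H \not\vdash e$ for every $e \in E$. A clause $C$ is guarded if there is a literal $G \in C$ with $\bigcup_{R \in C} \mathrm{vars}(R) \subseteq \mathrm{vars}(G)$. The ILP setting $\mathcal{G}$ has no background knowledge, hypothesis language the function-free guarded clauses, provability relation $\theta$-subsumption, and example language the ground clauses. The ILP consistency problem for $\mathcal{G}$: given finite sets $E^+$ (positive examples) and $E^-$ (negative examples) of ground clauses, decide whether there exists a function-free guarded clause $H$ (a solution) with $H \vdash E^+$, $H \not\vdash E^-$, and $\{H\}$ consistent. *)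

theory Defs
  imports Main "HOL-Computational_Algebra.Polynomial"
begin

section \<open>Turing machines, NP and NP-hardness\<close>

text \<open>
  Machines are nondeterministic with finitely many two-way infinite tapes. A tape is a pair of
  head position and contents, with 0 as the blank; the bits of the input are written with the
  symbols 1 and 2. A machine is given by its number of tapes and its transition relation;
  finiteness of that relation makes the sets of states and tape symbols finite. State 0 is
  initial, state 1 is accepting.
\<close>

datatype move = Move_Left | Stay | Move_Right

type_synonym tape = "int \<times> (int \<Rightarrow> nat)"
type_synonym config = "nat \<times> tape list"
type_synonym transitions = "((nat \<times> nat list) \<times> (nat \<times> (nat \<times> move) list)) set"

definition turing_machine :: "nat \<Rightarrow> transitions \<Rightarrow> bool" where
  "turing_machine k \<Delta> \<longleftrightarrow> k \<ge> 1 \<and> finite \<Delta> \<and>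
     (\<forall>((q, rs), (q', as)) \<in> \<Delta>. length rs = k \<and> length as = k)"

fun read_tape :: "tape \<Rightarrow> nat" where
  "read_tape (h, w) = w h"

fun move_head :: "move \<Rightarrow> int \<Rightarrow> int" where
  "move_head Move_Left h = h - 1"
| "move_head Stay h = h"
| "move_head Move_Right h = h + 1"

fun act_tape :: "nat \<times> move \<Rightarrow> tape \<Rightarrow> tape" where
  "act_tape (s, m) (h, w) = (move_head m h, w(h := s))"

definition step :: "transitions \<Rightarrow> (config \<times> config) set" where
  "step \<Delta> = {((q, ts), (q', map2 act_tape as ts)) | q ts q' as.
               ((q, map read_tape ts), (q', as)) \<in> \<Delta>}"

definition word_on_tape :: "bool list \<Rightarrow> int \<Rightarrow> nat" where
  "word_on_tape x i =
     (if 0 \<le> i \<and> i < int (length x) then if x ! nat i then 2 else 1 else 0)"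

definition init_config :: "nat \<Rightarrow> bool list \<Rightarrow> config" where
  "init_config k x = (0, (0, word_on_tape x) # replicate (k - 1) (0, word_on_tape []))"

definition accepts_within :: "nat \<Rightarrow> transitions \<Rightarrow> nat \<Rightarrow> bool list \<Rightarrow> bool" where
  "accepts_within k \<Delta> T x \<longleftrightarrow>
     (\<exists>t\<le>T. \<exists>ts. (init_config k x, (1, ts)) \<in> step \<Delta> ^^ t)"

text \<open>
  Only the length of some accepting computation is bounded; the other computations need not
  halt. This is the usual class, since a machine can be equipped with a polynomial clock.
\<close>

definition NP :: "bool list set set" where
  "NP = {L. \<exists>k \<Delta> (p :: nat poly). turing_machine k \<Delta> \<and>
              (\<forall>x. x \<in> L \<longleftrightarrow> accepts_within k \<Delta> (poly p (length x)) x)}"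

text \<open>The output of a halting computation is the contents of the last tape.\<close>

definition polytime_computable :: "(bool list \<Rightarrow> bool list) \<Rightarrow> bool" where
  "polytime_computable f \<longleftrightarrow>
     (\<exists>k \<Delta> (p :: nat poly). turing_machine k \<Delta> \<and> single_valued \<Delta> \<and>
        (\<forall>x. \<exists>t \<le> poly p (length x). \<exists>q ts.
           (init_config k x, (q, ts)) \<in> step \<Delta> ^^ t \<and>
           (q, ts) \<notin> Domain (step \<Delta>) \<and>
           snd (last ts) = word_on_tape (f x)))"

definition polytime_reducible :: "bool list set \<Rightarrow> bool list set \<Rightarrow> bool" where
  "polytime_reducible L L' \<longleftrightarrow>
     (\<exists>f. polytime_computable f \<and> (\<forall>x. x \<in> L \<longleftrightarrow> f x \<in> L'))"

definition NP_hard :: "bool list set \<Rightarrow> bool" where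
  "NP_hard L \<longleftrightarrow> (\<forall>L' \<in> NP. polytime_reducible L' L)"


section \<open>Clauses\<close>

text \<open>
  Symbols are identified by their names, which are words. As usual, occurrences of a function or
  predicate name with different numbers of arguments are different symbols. Constants are
  nullary function symbols.
\<close>

type_synonym symbol = "bool list"

datatype trm = Var symbol | Fun symbol "trm list"

datatype literal = Literal (positive: bool) (pred: symbol) (args: "trm list")

type_synonym clause = "literal set"

primrec vars_trm :: "trm \<Rightarrow> symbol set" where
  "vars_trm (Var x) = {x}"
| "vars_trm (Fun f ts) = \<Union> (set (map vars_trm ts))"

definition vars_literal :: "literal \<Rightarrow> symbol set" where
  "vars_literal L = (\<Union>t \<in> set (args L). vars_trm t)"

definition vars_clause :: "clause \<Rightarrow> symbol set" where
  "vars_clause C = (\<Union>L \<in> C. vars_literal L)"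

primrec subst_trm :: "(symbol \<Rightarrow> trm) \<Rightarrow> trm \<Rightarrow> trm" where
  "subst_trm \<theta> (Var x) = \<theta> x"
| "subst_trm \<theta> (Fun f ts) = Fun f (map (subst_trm \<theta>) ts)"

definition subst_literal :: "(symbol \<Rightarrow> trm) \<Rightarrow> literal \<Rightarrow> literal" where
  "subst_literal \<theta> L = Literal (positive L) (pred L) (map (subst_trm \<theta>) (args L))"

definition subsumes :: "clause \<Rightarrow> clause \<Rightarrow> bool" where
  "subsumes C D \<longleftrightarrow> (\<exists>\<theta>. subst_literal \<theta> ` C \<subseteq> D)"

definition ground :: "clause \<Rightarrow> bool" where
  "ground C \<longleftrightarrow> vars_clause C = {}"

definition guarded :: "clause \<Rightarrow> bool" where
  "guarded C \<longleftrightarrow> (\<exists>G \<in> C. (\<Union>R \<in> C. vars_literal R) \<subseteq> vars_literal G)"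

definition function_free :: "clause \<Rightarrow> bool" where
  "function_free C \<longleftrightarrow>
     (\<forall>L \<in> C. \<forall>t \<in> set (args L). (\<exists>x. t = Var x) \<or> (\<exists>c. t = Fun c []))"

text \<open>
  Consistency is satisfiability. Interpretations with domain \<^typ>\<open>nat\<close> suffice by
  Loewenheim-Skolem, as there is no equality and the signature is countable.
\<close>

primrec eval_trm :: "(symbol \<Rightarrow> nat list \<Rightarrow> nat) \<Rightarrow> (symbol \<Rightarrow> nat) \<Rightarrow> trm \<Rightarrow> nat" where
  "eval_trm F \<sigma> (Var x) = \<sigma> x"
| "eval_trm F \<sigma> (Fun f ts) = F f (map (eval_trm F \<sigma>) ts)"

definition holds_literal ::
  "(symbol \<Rightarrow> nat list \<Rightarrow> nat) \<Rightarrow> (symbol \<Rightarrow> nat list \<Rightarrow> bool) \<Rightarrow> (symbol \<Rightarrow> nat) \<Rightarrow> literal \<Rightarrow> bool"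
where
  "holds_literal F P \<sigma> L \<longleftrightarrow> (P (pred L) (map (eval_trm F \<sigma>) (args L)) \<longleftrightarrow> positive L)"

definition consistent :: "clause set \<Rightarrow> bool" where
  "consistent S \<longleftrightarrow> (\<exists>F P. \<forall>C \<in> S. \<forall>\<sigma>. \<exists>L \<in> C. holds_literal F P \<sigma> L)"

definition horn :: "clause \<Rightarrow> bool" where
  "horn C \<longleftrightarrow> card {L \<in> C. positive L} \<le> 1"

definition arity_at_most_2 :: "clause \<Rightarrow> bool" where
  "arity_at_most_2 C \<longleftrightarrow> (\<forall>L \<in> C. length (args L) \<le> 2)"

definition at_most_2_vars :: "clause \<Rightarrow> bool" where
  "at_most_2_vars C \<longleftrightarrow> card (vars_clause C) \<le> 2"

definition no_repeated_terms :: "clause \<Rightarrow> bool" where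
  "no_repeated_terms C \<longleftrightarrow> (\<forall>L \<in> C. distinct (args L))"


section \<open>The ILP consistency problem\<close>

definition guarded_clauses :: "clause set" where
  "guarded_clauses = {C. finite C \<and> function_free C \<and> guarded C}"

definition ground_clauses :: "clause set" where
  "ground_clauses = {C. finite C \<and> ground C}"

definition ilp_solution :: "clause \<Rightarrow> clause set \<Rightarrow> clause set \<Rightarrow> bool" where
  "ilp_solution H E\<^sub>p E\<^sub>n \<longleftrightarrow>
     (\<forall>e \<in> E\<^sub>p. subsumes H e) \<and> (\<forall>e \<in> E\<^sub>n. \<not> subsumes H e) \<and> consistent {H}"

text \<open>
  Instances are written down as lists of lists of literals; order and repetitions in these lists
  are immaterial. Each list element is preceded by \<^const>\<open>True\<close>, and the end of the list is
  marked by \<^const>\<open>False\<close>, which makes all codes below prefix-free.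
\<close>

definition encode_list :: "('a \<Rightarrow> bool list) \<Rightarrow> 'a list \<Rightarrow> bool list" where
  "encode_list e xs = concat (map (\<lambda>x. True # e x) xs) @ [False]"

lemma encode_list_cong [fundef_cong]:
  "xs = ys \<Longrightarrow> (\<And>x. x \<in> set ys \<Longrightarrow> e x = e' x) \<Longrightarrow> encode_list e xs = encode_list e' ys"
  by (simp add: encode_list_def cong: map_cong)

definition encode_symbol :: "symbol \<Rightarrow> bool list" where
  "encode_symbol = encode_list (\<lambda>b. [b])"

fun encode_trm :: "trm \<Rightarrow> bool list" where
  "encode_trm (Var x) = False # encode_symbol x"
| "encode_trm (Fun f ts) = True # encode_symbol f @ encode_list encode_trm ts"

definition encode_literal :: "literal \<Rightarrow> bool list" where
  "encode_literal L =
     positive L # encode_symbol (pred L) @ encode_list encode_trm (args L)"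

definition encode_examples :: "literal list list \<Rightarrow> bool list" where
  "encode_examples = encode_list (encode_list encode_literal)"

definition encode_instance :: "literal list list \<times> literal list list \<Rightarrow> bool list" where
  "encode_instance I = encode_examples (fst I) @ encode_examples (snd I)"

definition ilp_consistency :: "clause set \<Rightarrow> clause set \<Rightarrow> bool list set" where
  "ilp_consistency \<H> \<E> =
     {encode_instance (Ps, Ns) | Ps Ns.
        set ` set Ps \<subseteq> \<E> \<and> set ` set Ns \<subseteq> \<E> \<and>
        (\<exists>H \<in> \<H>. ilp_solution H (set ` set Ps) (set ` set Ns))}"

lemma encode_list_prefix_free:
  assumes "\<And>x y u v. x \<in> set xs \<Longrightarrow> e x @ u = e y @ v \<Longrightarrow> x = y \<and> u = v"
    and "encode_list e xs @ u = encode_list e ys @ v"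
  shows "xs = ys \<and> u = v"
  using assms
proof (induction xs arbitrary: ys)
  case Nil
  then show ?case by (cases ys) (auto simp: encode_list_def)
next
  case (Cons x xs)
  from Cons.prems(2) obtain y ys' where ys: "ys = y # ys'"
    by (cases ys) (auto simp: encode_list_def)
  have "e x @ (encode_list e xs @ u) = e y @ (encode_list e ys' @ v)"
    using Cons.prems(2) by (simp add: ys encode_list_def)
  then have *: "x = y" "encode_list e xs @ u = encode_list e ys' @ v"
    using Cons.prems(1)[of x] by auto
  have "xs = ys' \<and> u = v"
    using Cons.prems(1) *(2) by (intro Cons.IH) auto
  with * ys show ?case by simp
qed

lemma encode_symbol_prefix_free:
  "encode_symbol f @ u = encode_symbol g @ v \<Longrightarrow> f = g \<and> u = v"
  unfolding encode_symbol_def by (rule encode_list_prefix_free) auto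

lemma encode_trm_prefix_free:
  "encode_trm s @ u = encode_trm t @ v \<Longrightarrow> s = t \<and> u = v"
proof (induction s arbitrary: t u v)
  case (Var x)
  then show ?case by (cases t) (auto dest: encode_symbol_prefix_free)
next
  case (Fun f ss)
  from Fun.prems obtain g ts where t: "t = Fun g ts" by (cases t) auto
  with Fun.prems have "f = g \<and> encode_list encode_trm ss @ u = encode_list encode_trm ts @ v"
    by (intro encode_symbol_prefix_free) simp
  moreover from this have "ss = ts \<and> u = v"
    using Fun.IH by (intro encode_list_prefix_free[where e = encode_trm]) auto
  ultimately show ?case by (simp add: t)
qed

lemma encode_literal_prefix_free:
  assumes "encode_literal K @ u = encode_literal L @ v"
  shows "K = L \<and> u = v"
proof -
  from assms have "positive K = positive L"
    and "pred K = pred L \<and>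
      encode_list encode_trm (args K) @ u = encode_list encode_trm (args L) @ v"
    by (auto simp: encode_literal_def dest: encode_symbol_prefix_free)
  moreover from this have "args K = args L \<and> u = v"
    using encode_trm_prefix_free by (intro encode_list_prefix_free[where e = encode_trm]) auto
  ultimately show ?thesis by (simp add: literal.expand)
qed

lemma encode_examples_prefix_free:
  "encode_examples E @ u = encode_examples E' @ v \<Longrightarrow> E = E' \<and> u = v"
  unfolding encode_examples_def
  by (erule encode_list_prefix_free[rotated], erule encode_list_prefix_free[rotated])
    (rule encode_literal_prefix_free)

lemma inj_encode_instance: "inj encode_instance"
proof (rule injI)
  fix I J assume "encode_instance I = encode_instance J"
  then have "fst I = fst J \<and> encode_examples (snd I) = encode_examples (snd J)"
    unfolding encode_instance_def by (rule encode_examples_prefix_free)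
  then show "I = J"
    using encode_examples_prefix_free[of "snd I" "[]" "snd J" "[]"] by (simp add: prod_eq_iff)
qed

end

theory Submission
  imports Defs
begin

text \<open>
  Acceptance by a nondeterministic machine is reduced directly to the consistency problem, by one
  reduction that serves all restrictions. A computation is written as a tableau whose row \<open>t\<close> records
  the transition taken at time \<open>t\<close> and, in column \<open>T + z\<close>, the symbols found on all tapes at offset
  \<open>z\<close> from their heads. As the columns move with the heads, all constraints are binary and between
  neighbouring cells.

  To "cell \<open>(t, i)\<close> carries tile \<open>a\<close>" corresponds a unary predicate. Two positive examples that consist
  of all negative literals with these predicates, over different constants, force a guarded hypothesis to
  be a set \<open>S\<close> of such literals in a single variable. A positive example with two constants, each of which
  lacks one predicate, expresses that \<open>S\<close> omits one of these two, and a negative example that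
  lacks the predicates of a cell expresses that \<open>S\<close> contains one of them.

  That the reduction runs in polynomial time is obtained from a language of bounded loops over
  unary counters, each of which is the head position of a tape.
\<close>


section \<open>Structured programs for Turing machines\<close>

text \<open>Measuring columns from the heads lets one tile hold the symbols of all \<open>k\<close>
  tapes although the heads move independently: if a head moves by \<open>d\<close>, its tape shifts
  by \<open>d\<close> in the tableau, so every symbol comes from a cell at distance at most one.
  Equality of transitions along a row tells every cell how the heads move. What enters at the left
  and right border is unconstrained, but it travels at most one column per step, and
  \<open>T\<close> columns on either side keep it away from column \<open>T\<close> through time
  \<open>T\<close>.

  Two constants produce a disjunction because the single variable must be mapped to one of them, so
  that subsumption puts \<open>S\<close> inside one of two sets. Several tiles in one cell do no
  harm, as the constraints speak of all tiles in \<open>S\<close>.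

  All literals are negative and unary, which yields the Horn property, small arity and consistency
  without further effort. Conversely, only guardedness of a solution is exploited, so one instance
  serves every choice of restrictions.

  The set of tiles depends on the machine alone; only rows, columns and the time bound have to be
  handled by loops at run time.\<close>

datatype cmd =
  Act nat "nat option" move
| Then cmd cmd
| Cond "nat list \<Rightarrow> bool" cmd cmd
| While "nat list \<Rightarrow> bool" cmd

text \<open>Number of control states. The two extra states of \<open>Cond\<close> are the test and a
  jump from the end of \<open>c\<close> over \<open>d\<close>; those of \<open>While\<close> are the
  test and the jump back to it.\<close>

primrec len :: "cmd \<Rightarrow> nat" where
  "len (Act j a m) = 1"
| "len (Then c d) = len c + len d"
| "len (Cond b c d) = len c + len d + 2"
| "len (While b c) = len c + 2"

definition vecs :: "nat \<Rightarrow> nat list set" where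
  "vecs k = {rs. set rs \<subseteq> {0, 1, 2} \<and> length rs = k}"

definition stay :: "nat list \<Rightarrow> (nat \<times> move) list" where
  "stay rs = map (\<lambda>b. (b, Stay)) rs"

definition act :: "nat \<Rightarrow> nat option \<Rightarrow> move \<Rightarrow> nat list \<Rightarrow> (nat \<times> move) list" where
  "act j a m rs = (stay rs)[j := (case a of None \<Rightarrow> rs ! j | Some b \<Rightarrow> b, m)]"

text \<open>The block of a command is entered in state \<open>s\<close>, left through state
  \<open>s + len c\<close>, and owns the states from \<open>s\<close> up to but excluding this exit.
  Blocks are glued by making the exit of one the entry of the next.\<close>

primrec tm :: "nat \<Rightarrow> cmd \<Rightarrow> nat \<Rightarrow> transitions" where
  "tm k (Act j a m) s = (\<lambda>rs. ((s, rs), (s + 1, act j a m rs))) ` vecs k"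
| "tm k (Then c d) s = tm k c s \<union> tm k d (s + len c)"
| "tm k (Cond b c d) s =
     (\<lambda>rs. ((s, rs), (if b rs then s + 1 else s + 2 + len c, stay rs))) ` vecs k \<union>
     (\<lambda>rs. ((s + 1 + len c, rs), (s + 2 + len c + len d, stay rs))) ` vecs k \<union>
     tm k c (s + 1) \<union> tm k d (s + 2 + len c)"
| "tm k (While b c) s =
     (\<lambda>rs. ((s, rs), (if b rs then s + 1 else s + 2 + len c, stay rs))) ` vecs k \<union>
     (\<lambda>rs. ((s + 1 + len c, rs), (s, stay rs))) ` vecs k \<union> tm k c (s + 1)"

inductive run :: "nat \<Rightarrow> cmd \<Rightarrow> tape list \<Rightarrow> nat \<Rightarrow> tape list \<Rightarrow> bool" for k where
  run_act: "map read_tape ts \<in> vecs k \<Longrightarrow>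
     run k (Act j a m) ts 1 (map2 act_tape (act j a m (map read_tape ts)) ts)"
| run_then: "run k c ts t ts' \<Longrightarrow> run k d ts' u ts'' \<Longrightarrow> run k (Then c d) ts (t + u) ts''"
| run_cond_true: "map read_tape ts \<in> vecs k \<Longrightarrow> b (map read_tape ts) \<Longrightarrow> run k c ts t ts' \<Longrightarrow>
     map read_tape ts' \<in> vecs k \<Longrightarrow> run k (Cond b c d) ts (Suc (t + 1)) ts'"
| run_cond_false: "map read_tape ts \<in> vecs k \<Longrightarrow> \<not> b (map read_tape ts) \<Longrightarrow> run k d ts t ts' \<Longrightarrow>
     run k (Cond b c d) ts (Suc t) ts'"
| run_while_true: "map read_tape ts \<in> vecs k \<Longrightarrow> b (map read_tape ts) \<Longrightarrow> run k c ts t ts' \<Longrightarrow>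
     map read_tape ts' \<in> vecs k \<Longrightarrow> run k (While b c) ts' u ts'' \<Longrightarrow>
     run k (While b c) ts (Suc (t + Suc u)) ts''"
| run_while_false: "map read_tape ts \<in> vecs k \<Longrightarrow> \<not> b (map read_tape ts) \<Longrightarrow>
     run k (While b c) ts 1 ts"

lemma finite_tm: "finite (tm k c s)"
proof -
  have "finite (vecs k)"
    unfolding vecs_def by (rule finite_lists_length_eq) simp
  then show ?thesis by (induction c arbitrary: s) auto
qed

lemma length_tm:
  "((q, rs), (q', as)) \<in> tm k c s \<Longrightarrow> length rs = k \<and> length as = k"
  by (induction c arbitrary: s) (auto simp: vecs_def act_def stay_def)

text \<open>The exit state lies outside the block. This gives determinism, since subcommands own
  disjoint intervals of states, and halting, since nothing leaves the last exit.\<close>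

lemma source_tm: "((q, rs), y) \<in> tm k c s \<Longrightarrow> s \<le> q \<and> q < s + len c"
  by (induction c arbitrary: s) fastforce+

lemma single_valued_Un:
  assumes "single_valued A" "single_valued B" "Domain A \<inter> Domain B = {}"
  shows "single_valued (A \<union> B)"
  using assms unfolding single_valued_def by blast

lemma single_valued_row: "single_valued ((\<lambda>rs. ((s, rs), f rs)) ` V)"
  by (auto simp: single_valued_def)

lemma Domain_row: "Domain ((\<lambda>rs. ((s, rs), f rs)) ` V) = {s} \<times> V"
  by auto

lemma Domain_tm: "Domain (tm k c s) \<subseteq> {s..<s + len c} \<times> UNIV"
  using source_tm by fastforce

lemma single_valued_tm: "single_valued (tm k c s)"
proof (induction c arbitrary: s)
  case (Act j a m)
  show ?case unfolding tm.simps by (rule single_valued_row)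
next
  case (Then c d)
  have "Domain (tm k c s) \<inter> Domain (tm k d (s + len c)) = {}"
    using Domain_tm[of k c s] Domain_tm[of k d "s + len c"] by fastforce
  then show ?case unfolding tm.simps by (intro single_valued_Un Then)
next
  case (Cond b c d)
  note D = Domain_tm[of k c "s + 1"] Domain_tm[of k d "s + 2 + len c"]
  have "Domain (tm k c (s + 1)) \<inter> Domain (tm k d (s + 2 + len c)) = {}"
    using D by fastforce
  moreover have "({s} \<times> V \<union> {s + 1 + len c} \<times> V) \<inter> Domain (tm k c (s + 1)) = {}" for V
    using D(1) by fastforce
  moreover have "({s} \<times> V \<union> {s + 1 + len c} \<times> V) \<inter> Domain (tm k d (s + 2 + len c)) = {}" for V
    using D(2) by fastforce
  ultimately show ?case unfolding tm.simps
    by (intro single_valued_Un Cond single_valued_row)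
      (simp_all only: Domain_Un_eq Domain_row Int_Un_distrib2 Un_empty, auto)
next
  case (While b c)
  have "({s} \<times> V \<union> {s + 1 + len c} \<times> V) \<inter> Domain (tm k c (s + 1)) = {}" for V
    using Domain_tm[of k c "s + 1"] by fastforce
  then show ?case unfolding tm.simps
    by (intro single_valued_Un While single_valued_row)
      (simp_all only: Domain_Un_eq Domain_row, auto)
qed

lemma act_tape_stay [simp]: "act_tape (read_tape T, Stay) T = T"
  by (cases T) simp

lemma step_stay:
  assumes "((q, map read_tape ts), (q', stay (map read_tape ts))) \<in> \<Delta>"
  shows "((q, ts), (q', ts)) \<in> step \<Delta>"
proof -
  have "map2 act_tape (stay (map read_tape ts)) ts = ts"
    by (rule nth_equalityI) (simp_all add: stay_def)
  with assms show ?thesis unfolding step_def by force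
qed

text \<open>\<open>\<Delta>\<close> is an arbitrary superset so that the induction can run a
  subcommand inside the machine of the enclosing command.\<close>

lemma run_tm:
  "run k c ts t ts' \<Longrightarrow> tm k c s \<subseteq> \<Delta> \<Longrightarrow> ((s, ts), (s + len c, ts')) \<in> step \<Delta> ^^ t"
proof (induction arbitrary: s rule: run.induct)
  case (run_act ts j a m)
  then have "((s, map read_tape ts), (s + 1, act j a m (map read_tape ts))) \<in> \<Delta>" by auto
  then show ?case by (auto simp: step_def)
next
  case (run_then c ts t ts' d u ts'')
  then have "((s, ts), (s + len c, ts')) \<in> step \<Delta> ^^ t"
    "((s + len c, ts'), (s + len c + len d, ts'')) \<in> step \<Delta> ^^ u" by auto
  then show ?case by (auto simp: relpow_add add.assoc)
next
  case (run_cond_true ts b c t ts' d)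
  then have "((s, ts), (s + 1, ts)) \<in> step \<Delta>"
    by (intro step_stay) (force simp del: One_nat_def)
  moreover have "((s + 1, ts), (s + 1 + len c, ts')) \<in> step \<Delta> ^^ t"
    using run_cond_true by (intro run_cond_true.IH) auto
  moreover have "((s + 1 + len c, ts'), (s + len (Cond b c d), ts')) \<in> step \<Delta>"
    using run_cond_true by (intro step_stay) force
  then have "((s + 1 + len c, ts'), (s + len (Cond b c d), ts')) \<in> step \<Delta> ^^ 1" by simp
  ultimately show ?case by (intro relpow_Suc_I2 relpow_trans)
next
  case (run_cond_false ts b d t ts' c)
  then have "((s, ts), (s + 2 + len c, ts)) \<in> step \<Delta>"
    by (intro step_stay) force
  moreover have "((s + 2 + len c, ts), (s + 2 + len c + len d, ts')) \<in> step \<Delta> ^^ t"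
    using run_cond_false by (intro run_cond_false.IH) auto
  ultimately have "((s, ts), (s + 2 + len c + len d, ts')) \<in> step \<Delta> ^^ Suc t"
    by (rule relpow_Suc_I2)
  then show ?case by (simp add: add_ac del: relpow.simps)
next
  case (run_while_true ts b c t ts' u ts'')
  then have "((s, ts), (s + 1, ts)) \<in> step \<Delta>"
    by (intro step_stay) (force simp del: One_nat_def)
  moreover have "((s + 1, ts), (s + 1 + len c, ts')) \<in> step \<Delta> ^^ t"
    using run_while_true.prems by (intro run_while_true.IH) auto
  moreover have "((s + 1 + len c, ts'), (s, ts')) \<in> step \<Delta>"
    using run_while_true by (intro step_stay) force
  moreover have "((s, ts'), (s + len (While b c), ts'')) \<in> step \<Delta> ^^ u"
    using run_while_true.prems by (intro run_while_true.IH)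
  ultimately show ?case by (intro relpow_Suc_I2 relpow_trans)
next
  case (run_while_false ts b c)
  then have "((s, ts), (s + 2 + len c, ts)) \<in> step \<Delta>"
    by (intro step_stay) force
  then show ?case by (simp add: add_ac)
qed


section \<open>A loop language with polynomial running time\<close>

definition runs :: "nat \<Rightarrow> cmd \<Rightarrow> tape list \<Rightarrow> nat \<Rightarrow> tape list \<Rightarrow> bool" where
  "runs k c ts B ts' \<longleftrightarrow> (\<exists>t\<le>B. run k c ts t ts')"

lemma runs_act:
  assumes "map read_tape ts \<in> vecs k" "j < k"
  shows "runs k (Act j a m) ts 1
    (ts[j := act_tape (case a of None \<Rightarrow> read_tape (ts ! j) | Some b \<Rightarrow> b, m) (ts ! j)])"
proof -
  have "length ts = k" using assms(1) by (simp add: vecs_def)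
  then have "map2 act_tape (act j a m (map read_tape ts)) ts =
    ts[j := act_tape (case a of None \<Rightarrow> read_tape (ts ! j) | Some b \<Rightarrow> b, m) (ts ! j)]"
    using assms(2)
    by (intro nth_equalityI) (auto simp: act_def stay_def nth_list_update split: option.split)
  then show ?thesis unfolding runs_def using run_act[OF assms(1), of j a m] by auto
qed

lemma runs_mono: "runs k c ts B ts' \<Longrightarrow> B \<le> B' \<Longrightarrow> runs k c ts B' ts'"
  unfolding runs_def by (meson le_trans)

lemma runs_then: "runs k c ts B ts' \<Longrightarrow> runs k d ts' B' ts'' \<Longrightarrow> runs k (Then c d) ts (B + B') ts''"
  unfolding runs_def by (meson add_le_mono run_then)

text \<open>
  In a state \<open>(h, \<rho>, w)\<close> the head of the input tape is at \<open>h\<close>, register \<open>r\<close> is the position of the head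
  of tape \<open>r\<close>, and \<open>w\<close> is the output. The symbol 1 at position 0 of a register tape allows tests for 0.
\<close>

fun tape_of :: "nat \<Rightarrow> bool list \<Rightarrow> nat \<times> (nat \<Rightarrow> nat) \<times> bool list \<Rightarrow> nat \<Rightarrow> tape" where
  "tape_of m x (h, \<rho>, w) j =
     (if j = 0 then (int h, word_on_tape x)
      else if j \<le> m then (int (\<rho> j), (word_on_tape [])(0 := 1))
      else (int (length w), word_on_tape w))"

definition rep :: "nat \<Rightarrow> bool list \<Rightarrow> nat \<times> (nat \<Rightarrow> nat) \<times> bool list \<Rightarrow> tape list" where
  "rep m x S = map (tape_of m x S) [0..<m + 2]"

definition reads :: "nat \<Rightarrow> bool list \<Rightarrow> nat \<times> (nat \<Rightarrow> nat) \<times> bool list \<Rightarrow> nat list" where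
  "reads m x S = map read_tape (rep m x S)"

definition exec :: "nat \<Rightarrow> bool list \<Rightarrow> cmd \<Rightarrow> nat \<times> (nat \<Rightarrow> nat) \<times> bool list \<Rightarrow> nat \<Rightarrow>
    nat \<times> (nat \<Rightarrow> nat) \<times> bool list \<Rightarrow> bool" where
  "exec m x c S B S' \<longleftrightarrow> runs (m + 2) c (rep m x S) B (rep m x S')"

lemma reads_vecs: "reads m x S \<in> vecs (m + 2)"
proof -
  have "read_tape (tape_of m x S i) \<in> {0, 1, 2}" for i
    by (cases S) (simp add: word_on_tape_def)
  moreover have "set (reads m x S) = (\<lambda>i. read_tape (tape_of m x S i)) ` {0..<m + 2}"
    by (simp only: reads_def rep_def set_map set_upt image_image)
  ultimately have "set (reads m x S) \<subseteq> {0, 1, 2}" by (simp only: image_subset_iff) blast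
  then show ?thesis by (simp add: reads_def rep_def vecs_def)
qed

lemma nth_reads:
  "j < m + 2 \<Longrightarrow> reads m x S ! j = read_tape (tape_of m x S j)"
  by (simp add: reads_def rep_def del: upt_Suc)

lemma list_update_map_upt: "(map f [0..<n])[j := y] = map (f(j := y)) [0..<n]"
  by (intro nth_equalityI) (auto simp: nth_list_update)

lemma exec_act:
  assumes "j < m + 2"
    "\<And>i. i < m + 2 \<Longrightarrow> tape_of m x S' i =
      ((tape_of m x S)(j := act_tape (case a of None \<Rightarrow> read_tape (tape_of m x S j) | Some b \<Rightarrow> b, mv)
        (tape_of m x S j))) i"
  shows "exec m x (Act j a mv) S 1 S'"
proof -
  have "rep m x S ! j = tape_of m x S j"
    using assms(1) by (simp add: rep_def del: upt_Suc)
  moreover have "rep m x S' = (rep m x S)[j :=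
      act_tape (case a of None \<Rightarrow> read_tape (tape_of m x S j) | Some b \<Rightarrow> b, mv) (tape_of m x S j)]"
    unfolding rep_def list_update_map_upt using assms(2) by (intro map_cong) auto
  moreover have "runs (m + 2) (Act j a mv) (rep m x S) 1
      ((rep m x S)[j := act_tape (case a of None \<Rightarrow> read_tape (rep m x S ! j) | Some b \<Rightarrow> b, mv)
        (rep m x S ! j)])"
    using reads_vecs assms(1) by (intro runs_act) (auto simp: reads_def)
  ultimately show ?thesis by (simp only: exec_def)
qed

lemma exec_mono: "exec m x c S B S' \<Longrightarrow> B \<le> B' \<Longrightarrow> exec m x c S B' S'"
  unfolding exec_def by (rule runs_mono)

lemma exec_then:
  "exec m x c S B S' \<Longrightarrow> exec m x d S' B' S'' \<Longrightarrow> exec m x (Then c d) S (B + B') S''"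
  unfolding exec_def by (rule runs_then)

lemma exec_cond:
  assumes "b (reads m x S) \<Longrightarrow> exec m x c S B S'"
    and "\<not> b (reads m x S) \<Longrightarrow> exec m x d S B S'"
  shows "exec m x (Cond b c d) S (B + 2) S'"
proof (cases "b (reads m x S)")
  case True
  with assms obtain t where "t \<le> B" "run (m + 2) c (rep m x S) t (rep m x S')"
    by (auto simp: exec_def runs_def)
  moreover from this True have "run (m + 2) (Cond b c d) (rep m x S) (Suc (t + 1)) (rep m x S')"
    using reads_vecs by (intro run_cond_true) (auto simp: reads_def)
  ultimately show ?thesis unfolding exec_def runs_def by (intro exI[of _ "Suc (t + 1)"]) simp
next
  case False
  with assms obtain t where "t \<le> B" "run (m + 2) d (rep m x S) t (rep m x S')"
    by (auto simp: exec_def runs_def)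
  moreover from this False have "run (m + 2) (Cond b c d) (rep m x S) (Suc t) (rep m x S')"
    using reads_vecs by (intro run_cond_false) (auto simp: reads_def)
  ultimately show ?thesis unfolding exec_def runs_def by (intro exI[of _ "Suc t"]) simp
qed

text \<open>The invariant is given as the explicit sequence of states before each iteration. Every
  iteration pays 2 steps for the test and the jump back, the failing test pays 1. The induction
  counts the iterations that remain.\<close>

lemma exec_while:
  assumes "\<And>i. i < N \<Longrightarrow> b (reads m x (S i))" "\<not> b (reads m x (S N))"
    and "\<And>i. i < N \<Longrightarrow> exec m x c (S i) B (S (Suc i))"
  shows "exec m x (While b c) (S 0) (N * (B + 2) + 1) (S N)"
proof -
  have "exec m x (While b c) (S (N - j)) (j * (B + 2) + 1) (S N)" if "j \<le> N" for j
    using that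
  proof (induction j)
    case 0
    have "run (m + 2) (While b c) (rep m x (S N)) 1 (rep m x (S N))"
      using assms(2) reads_vecs by (intro run_while_false) (auto simp: reads_def)
    then show ?case by (auto simp: exec_def runs_def)
  next
    case (Suc j)
    let ?i = "N - Suc j"
    have i: "?i < N" "Suc ?i = N - j" using Suc.prems by auto
    obtain t where t: "t \<le> B" "run (m + 2) c (rep m x (S ?i)) t (rep m x (S (N - j)))"
      using assms(3)[OF i(1)] i(2) by (auto simp: exec_def runs_def)
    obtain u where u: "u \<le> j * (B + 2) + 1" "run (m + 2) (While b c) (rep m x (S (N - j))) u (rep m x (S N))"
      using Suc by (auto simp: exec_def runs_def)
    have "run (m + 2) (While b c) (rep m x (S ?i)) (Suc (t + Suc u)) (rep m x (S N))"
      using assms(1)[OF i(1)] t u reads_vecs by (intro run_while_true) (auto simp: reads_def)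
    moreover have "Suc (t + Suc u) \<le> Suc j * (B + 2) + 1" using t u by simp
    ultimately show ?case unfolding exec_def runs_def by blast
  qed
  from this[of N] show ?thesis by simp
qed

section \<open>Elementary operations on registers, input head and output\<close>

abbreviation inc :: "nat \<Rightarrow> cmd" where "inc r \<equiv> Act r None Move_Right"
abbreviation dec :: "nat \<Rightarrow> cmd" where "dec r \<equiv> Act r None Move_Left"
abbreviation skip :: cmd where "skip \<equiv> Act 0 None Stay"
abbreviation nonzero :: "nat \<Rightarrow> nat list \<Rightarrow> bool" where "nonzero r \<equiv> \<lambda>rs. rs ! r \<noteq> 1"

lemma exec_inc:
  "1 \<le> r \<Longrightarrow> r \<le> m \<Longrightarrow> exec m x (inc r) (h, \<rho>, w) 1 (h, \<rho>(r := Suc (\<rho> r)), w)"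
  by (rule exec_act) (auto simp: fun_eq_iff)

lemma exec_dec:
  "1 \<le> r \<Longrightarrow> r \<le> m \<Longrightarrow> 0 < \<rho> r \<Longrightarrow> exec m x (dec r) (h, \<rho>, w) 1 (h, \<rho>(r := \<rho> r - 1), w)"
  by (rule exec_act) (auto simp: fun_eq_iff)

lemma exec_skip: "exec m x skip S 1 S"
  by (cases S) (rule exec_act, auto simp: fun_eq_iff)

lemma exec_input_right: "exec m x (inc 0) (h, \<rho>, w) 1 (Suc h, \<rho>, w)"
  by (rule exec_act) (auto simp: fun_eq_iff)

lemma exec_input_left: "0 < h \<Longrightarrow> exec m x (dec 0) (h, \<rho>, w) 1 (h - 1, \<rho>, w)"
  by (rule exec_act) (auto simp: fun_eq_iff)

lemma exec_output:
  "exec m x (Act (m + 1) (Some (if b then 2 else 1)) Move_Right) (h, \<rho>, w) 1 (h, \<rho>, w @ [b])"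
  by (rule exec_act) (auto simp: fun_eq_iff word_on_tape_def nth_append nat_less_iff)

lemma reads_reg [simp]:
  "1 \<le> r \<Longrightarrow> r \<le> m \<Longrightarrow> reads m x (h, \<rho>, w) ! r = Suc 0 \<longleftrightarrow> \<rho> r = 0"
  by (simp add: nth_reads word_on_tape_def)

text \<open>
  \<open>For r s p\<close> runs \<open>p\<close> with \<open>r\<close> ranging over the numbers below register \<open>s\<close>, \<open>ForIn r p q\<close> runs
  \<open>p\<close> or \<open>q\<close> with \<open>r\<close> ranging over the positions of the input, depending on the bit, and
  \<open>LetLen r p q\<close> runs \<open>q\<close> with \<open>r\<close> set to the length of the output of \<open>p\<close>, which is the only form of
  arithmetic. \<open>y\<close> in \<open>IfEq y r s p q\<close> is a scratch register.
\<close>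

datatype prog =
  Emit "bool list"
| Seq prog prog
| For nat nat prog
| ForIn nat prog prog
| LetLen nat prog prog
| IfEq nat nat nat prog prog

primrec out :: "prog \<Rightarrow> bool list \<Rightarrow> (nat \<Rightarrow> nat) \<Rightarrow> bool list" where
  "out (Emit u) x \<sigma> = u"
| "out (Seq p q) x \<sigma> = out p x \<sigma> @ out q x \<sigma>"
| "out (For r s p) x \<sigma> = concat (map (\<lambda>i. out p x (\<sigma>(r := i))) [0..<\<sigma> s])"
| "out (ForIn r p q) x \<sigma> =
     concat (map (\<lambda>i. if x ! i then out p x (\<sigma>(r := i)) else out q x (\<sigma>(r := i))) [0..<length x])"
| "out (LetLen r p q) x \<sigma> = out q x (\<sigma>(r := length (out p x \<sigma>)))"
| "out (IfEq y r s p q) x \<sigma> = (if \<sigma> r = \<sigma> s then out p x \<sigma> else out q x \<sigma>)"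

text \<open>
  \<open>A\<close> are the registers that may be read, the registers from \<open>d\<close> on are 0, and \<open>a\<close> says that the
  head of the input tape is at position 0. \<open>For r\<close> uses \<open>r + 1\<close> to count the remaining iterations.
\<close>

primrec wf_prog :: "nat \<Rightarrow> bool \<Rightarrow> nat set \<Rightarrow> nat \<Rightarrow> prog \<Rightarrow> bool" where
  "wf_prog m a A d (Emit u) \<longleftrightarrow> True"
| "wf_prog m a A d (Seq p q) \<longleftrightarrow> wf_prog m a A d p \<and> wf_prog m a A d q"
| "wf_prog m a A d (For r s p) \<longleftrightarrow>
     d \<le> r \<and> r < m \<and> s \<in> A \<and> wf_prog m a (insert r A) (r + 2) p"
| "wf_prog m a A d (ForIn r p q) \<longleftrightarrow>
     a \<and> d \<le> r \<and> r \<le> m \<and> wf_prog m False (insert r A) (r + 1) p \<and> wf_prog m False (insert r A) (r + 1) q"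
| "wf_prog m a A d (LetLen r p q) \<longleftrightarrow>
     d \<le> r \<and> r \<le> m \<and> wf_prog m a A (r + 1) p \<and> wf_prog m a (insert r A) (r + 1) q"
| "wf_prog m a A d (IfEq y r s p q) \<longleftrightarrow>
     d \<le> y \<and> y \<le> m \<and> r \<in> A \<and> s \<in> A \<and> r \<noteq> s \<and> wf_prog m a A d p \<and> wf_prog m a A d q"

text \<open>With a register \<open>g\<close> as target, a program writes no word but counts in
  \<open>g\<close> the length of what it would emit. In this way \<open>LetLen\<close> can run any
  program as an arithmetic expression.\<close>

definition emit :: "nat \<Rightarrow> nat option \<Rightarrow> bool \<Rightarrow> cmd" where
  "emit m tgt b = (case tgt of
     None \<Rightarrow> Act (m + 1) (Some (if b then 2 else 1)) Move_Right | Some g \<Rightarrow> inc g)"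

text \<open>A register can only be tested for 0, so its value is learned by emptying it.
  \<open>For\<close> moves \<open>s\<close> into both \<open>r\<close> and \<open>r + 1\<close>,
  refills \<open>s\<close> from \<open>r\<close>, and then lets \<open>r\<close> count up while
  \<open>r + 1\<close> counts down. \<open>IfEq\<close> decrements \<open>r\<close> and
  \<open>s\<close> in parallel and keeps the count in \<open>y\<close>; they were equal iff both end
  at 0, and either branch refills them first. \<open>ForIn\<close> keeps \<open>r\<close> in step
  with the input head, so that \<open>r\<close> tells how far to go back.\<close>

primrec compile :: "nat \<Rightarrow> nat option \<Rightarrow> prog \<Rightarrow> cmd" where
  "compile m tgt (Emit u) = foldr (\<lambda>b. Then (emit m tgt b)) u skip"
| "compile m tgt (Seq p q) = Then (compile m tgt p) (compile m tgt q)"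
| "compile m tgt (For r s p) =
     Then (While (nonzero s) (Then (dec s) (Then (inc r) (inc (r + 1)))))
    (Then (While (nonzero r) (Then (dec r) (inc s)))
    (Then (While (nonzero (r + 1)) (Then (dec (r + 1)) (Then (compile m tgt p) (inc r))))
          (While (nonzero r) (dec r))))"
| "compile m tgt (ForIn r p q) =
     Then (While (\<lambda>rs. rs ! 0 \<noteq> 0)
            (Then (Cond (\<lambda>rs. rs ! 0 = 2) (compile m tgt p) (compile m tgt q)) (Then (inc 0) (inc r))))
          (While (nonzero r) (Then (dec r) (dec 0)))"
| "compile m tgt (LetLen r p q) =
     Then (compile m (Some r) p) (Then (compile m tgt q) (While (nonzero r) (dec r)))"
| "compile m tgt (IfEq y r s p q) =
     Then (While (\<lambda>rs. nonzero r rs \<and> nonzero s rs) (Then (dec r) (Then (dec s) (inc y))))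
       (Cond (\<lambda>rs. nonzero r rs \<or> nonzero s rs)
         (Then (While (nonzero y) (Then (dec y) (Then (inc r) (inc s)))) (compile m tgt q))
         (Then (While (nonzero y) (Then (dec y) (Then (inc r) (inc s)))) (compile m tgt p)))"

section \<open>Correctness and running time of compiled programs\<close>

definition emit_reg :: "nat option \<Rightarrow> bool list \<Rightarrow> (nat \<Rightarrow> nat) \<Rightarrow> nat \<Rightarrow> nat" where
  "emit_reg tgt u \<rho> = (case tgt of None \<Rightarrow> \<rho> | Some g \<Rightarrow> \<rho>(g := \<rho> g + length u))"

definition emit_word :: "nat option \<Rightarrow> bool list \<Rightarrow> bool list \<Rightarrow> bool list" where
  "emit_word tgt u w = (case tgt of None \<Rightarrow> w @ u | Some g \<Rightarrow> w)"

lemma emit_reg_simps [simp]: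
  "emit_reg tgt [] \<rho> = \<rho>"
  "emit_reg None u \<rho> = \<rho>"
  "emit_reg (Some g) u \<rho> = \<rho>(g := \<rho> g + length u)"
  "emit_reg tgt v (emit_reg tgt u \<rho>) = emit_reg tgt (u @ v) \<rho>"
  "tgt \<noteq> Some r \<Longrightarrow> emit_reg tgt u \<rho> r = \<rho> r"
  "tgt \<noteq> Some r \<Longrightarrow> (emit_reg tgt u \<rho>)(r := v') = emit_reg tgt u (\<rho>(r := v'))"
  by (auto simp: emit_reg_def fun_eq_iff split: option.splits)

lemma emit_word_simps [simp]:
  "emit_word tgt [] w = w"
  "emit_word None u w = w @ u"
  "emit_word (Some g) u w = w"
  "emit_word tgt v (emit_word tgt u w) = emit_word tgt (u @ v) w"
  by (auto simp: emit_word_def split: option.splits)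

text \<open>\<open>\<sigma>\<close> is the environment of the semantics and \<open>\<rho>\<close>
  the actual registers; they agree on \<open>A\<close> only, which leaves the target register free
  to change. \<open>B\<close> bounds the readable registers and hence the iterations of
  \<open>For\<close>. \<open>Q\<close> bounds time and output length at once, because under
  \<open>LetLen\<close> an output length becomes a register value and thereby part of a new bound.
  Apart from the target, all registers and the input head are restored.\<close>

definition correct :: "nat \<Rightarrow> bool \<Rightarrow> nat set \<Rightarrow> nat \<Rightarrow> nat poly \<Rightarrow> prog \<Rightarrow> nat poly \<Rightarrow> bool" where
  "correct m a A d B p Q \<longleftrightarrow> (\<forall>x h \<sigma> \<rho> w tgt.
     (a \<longrightarrow> h = 0) \<longrightarrow> (\<forall>r\<in>A. \<rho> r = \<sigma> r \<and> \<sigma> r \<le> poly B (length x)) \<longrightarrow> (\<forall>r\<ge>d. \<rho> r = 0) \<longrightarrow>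
     (\<forall>g. tgt = Some g \<longrightarrow> 1 \<le> g \<and> g < d \<and> g \<le> m \<and> g \<notin> A) \<longrightarrow>
     length (out p x \<sigma>) \<le> poly Q (length x) \<and>
     exec m x (compile m tgt p) (h, \<rho>, w) (poly Q (length x))
       (h, emit_reg tgt (out p x \<sigma>) \<rho>, emit_word tgt (out p x \<sigma>) w))"

lemma correctI:
  assumes "\<And>x h \<sigma> \<rho> w tgt.
     a \<longrightarrow> h = 0 \<Longrightarrow> \<forall>r\<in>A. \<rho> r = \<sigma> r \<and> \<sigma> r \<le> poly B (length x) \<Longrightarrow> \<forall>r\<ge>d. \<rho> r = 0 \<Longrightarrow>
     \<forall>g. tgt = Some g \<longrightarrow> 1 \<le> g \<and> g < d \<and> g \<le> m \<and> g \<notin> A \<Longrightarrow>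
     length (out p x \<sigma>) \<le> poly Q (length x) \<and>
     exec m x (compile m tgt p) (h, \<rho>, w) (poly Q (length x))
       (h, emit_reg tgt (out p x \<sigma>) \<rho>, emit_word tgt (out p x \<sigma>) w)"
  shows "correct m a A d B p Q"
  using assms unfolding correct_def by blast

lemma correctD:
  assumes "correct m a A d B p Q" "a \<longrightarrow> h = 0"
    "\<forall>r\<in>A. \<rho> r = \<sigma> r \<and> \<sigma> r \<le> poly B (length x)" "\<forall>r\<ge>d. \<rho> r = 0"
    "\<forall>g. tgt = Some g \<longrightarrow> 1 \<le> g \<and> g < d \<and> g \<le> m \<and> g \<notin> A"
  shows "length (out p x \<sigma>) \<le> poly Q (length x)"
    "exec m x (compile m tgt p) (h, \<rho>, w) (poly Q (length x))
       (h, emit_reg tgt (out p x \<sigma>) \<rho>, emit_word tgt (out p x \<sigma>) w)"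
  using assms unfolding correct_def by blast+

lemma exec_emit:
  assumes "\<And>g. tgt = Some g \<Longrightarrow> 1 \<le> g \<and> g \<le> m"
  shows "exec m x (emit m tgt b) (h, \<rho>, w) 1 (h, emit_reg tgt [b] \<rho>, emit_word tgt [b] w)"
proof (cases tgt)
  case None
  then show ?thesis by (simp add: emit_def exec_output del: One_nat_def)
next
  case (Some g)
  then show ?thesis using assms exec_inc[of g m x h \<rho> w] by (simp add: emit_def del: One_nat_def)
qed

lemma correct_Emit: "correct m a A d B (Emit u) [:length u + 1:]"
proof (rule correctI)
  fix x :: "bool list" and h :: nat and w :: "bool list" and \<rho> \<sigma> :: "nat \<Rightarrow> nat" and tgt
  assume tgt: "\<forall>g. tgt = Some g \<longrightarrow> 1 \<le> g \<and> g < d \<and> g \<le> m \<and> g \<notin> A"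
  have "exec m x (compile m tgt (Emit u)) (h, \<rho>, w) (length u + 1)
      (h, emit_reg tgt u \<rho>, emit_word tgt u w)"
  proof (induction u arbitrary: \<rho> w)
    case Nil
    show ?case using exec_skip[of m x "(h, \<rho>, w)"] by simp
  next
    case (Cons b u)
    have "exec m x (Then (emit m tgt b) (compile m tgt (Emit u))) (h, \<rho>, w) (1 + (length u + 1))
      (h, emit_reg tgt u (emit_reg tgt [b] \<rho>), emit_word tgt u (emit_word tgt [b] w))"
      using tgt by (intro exec_then[OF exec_emit Cons.IH]) auto
    then show ?case by simp
  qed
  then show "length (out (Emit u) x \<sigma>) \<le> poly [:length u + 1:] (length x) \<and>
    exec m x (compile m tgt (Emit u)) (h, \<rho>, w) (poly [:length u + 1:] (length x))
     (h, emit_reg tgt (out (Emit u) x \<sigma>) \<rho>, emit_word tgt (out (Emit u) x \<sigma>) w)"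
    by simp
qed

lemma correct_Seq:
  assumes "correct m a A d B p P" "correct m a A d B q Q"
  shows "correct m a A d B (Seq p q) (P + Q)"
proof (rule correctI)
  fix x :: "bool list" and h :: nat and w :: "bool list" and \<rho> \<sigma> :: "nat \<Rightarrow> nat" and tgt
  assume *: "a \<longrightarrow> h = 0" "\<forall>r\<in>A. \<rho> r = \<sigma> r \<and> \<sigma> r \<le> poly B (length x)" "\<forall>r\<ge>d. \<rho> r = 0"
    "\<forall>g. tgt = Some g \<longrightarrow> 1 \<le> g \<and> g < d \<and> g \<le> m \<and> g \<notin> A"
  let ?\<rho> = "emit_reg tgt (out p x \<sigma>) \<rho>"
  let ?w = "emit_word tgt (out p x \<sigma>) w"
  have ne: "tgt \<noteq> Some r" if "r \<in> A \<or> d \<le> r" for r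
    using that *(4) by auto
  note p = correctD[OF assms(1) *]
  have "\<forall>r\<in>A. ?\<rho> r = \<sigma> r \<and> \<sigma> r \<le> poly B (length x)" "\<forall>r\<ge>d. ?\<rho> r = 0"
    using * ne by auto
  note q = correctD[OF assms(2) *(1) this *(4)]
  have "exec m x (compile m tgt (Seq p q)) (h, \<rho>, w) (poly P (length x) + poly Q (length x))
     (h, emit_reg tgt (out (Seq p q) x \<sigma>) \<rho>, emit_word tgt (out (Seq p q) x \<sigma>) w)"
    using exec_then[OF p(2) q(2)] by simp
  with p(1) q(1) show "length (out (Seq p q) x \<sigma>) \<le> poly (P + Q) (length x) \<and>
    exec m x (compile m tgt (Seq p q)) (h, \<rho>, w) (poly (P + Q) (length x))
     (h, emit_reg tgt (out (Seq p q) x \<sigma>) \<rho>, emit_word tgt (out (Seq p q) x \<sigma>) w)"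
    by simp
qed

lemma exec_cong: "exec m x c S B S' \<Longrightarrow> S' = S'' \<Longrightarrow> exec m x c S B S''"
  by simp

lemma exec_move:
  assumes "distinct [s, r]" "{s, r} \<subseteq> {1..m}" "0 < \<rho> s"
  shows "exec m x (Then (dec s) (inc r)) (h, \<rho>, w) (1 + 1) (h, \<rho>(s := \<rho> s - 1, r := Suc (\<rho> r)), w)"
  using assms by (intro exec_then[OF exec_dec exec_cong[OF exec_inc]]) auto

lemma exec_move2:
  assumes "distinct [s, r, t]" "{s, r, t} \<subseteq> {1..m}" "0 < \<rho> s"
  shows "exec m x (Then (dec s) (Then (inc r) (inc t))) (h, \<rho>, w) (1 + (1 + 1))
    (h, \<rho>(s := \<rho> s - 1, r := Suc (\<rho> r), t := Suc (\<rho> t)), w)"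
  using assms by (intro exec_then[OF exec_dec exec_then[OF exec_inc exec_cong[OF exec_inc]]]) auto

lemma exec_move_from2:
  assumes "distinct [s, r, t]" "{s, r, t} \<subseteq> {1..m}" "0 < \<rho> s" "0 < \<rho> r"
  shows "exec m x (Then (dec s) (Then (dec r) (inc t))) (h, \<rho>, w) (1 + (1 + 1))
    (h, \<rho>(s := \<rho> s - 1, r := \<rho> r - 1, t := Suc (\<rho> t)), w)"
  using assms by (intro exec_then[OF exec_dec exec_then[OF exec_dec exec_cong[OF exec_inc]]]) auto

lemma exec_clear:
  assumes "1 \<le> r" "r \<le> m"
  shows "exec m x (While (nonzero r) (dec r)) (h, \<rho>, w) (\<rho> r * (1 + 2) + 1) (h, \<rho>(r := 0), w)"
proof -
  define S where "S i = (h, \<rho>(r := \<rho> r - i), w)" for i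
  have "exec m x (While (nonzero r) (dec r)) (S 0) (\<rho> r * (1 + 2) + 1) (S (\<rho> r))"
  proof (rule exec_while)
    fix i assume "i < \<rho> r"
    then show "exec m x (dec r) (S i) 1 (S (Suc i))"
      unfolding S_def using assms by (intro exec_cong[OF exec_dec]) auto
  qed (use assms in \<open>auto simp: S_def\<close>)
  then show ?thesis by (simp add: S_def)
qed

text \<open>With \<open>q\<close> the bound for the body, the four loops cost \<open>5\<close>,
  \<open>4\<close>, \<open>q + 4\<close> and \<open>3\<close> steps per iteration, whence
  \<open>16\<close>, and one failing test each, whence \<open>4\<close>. The number of iterations is
  a register value, so \<open>B\<close> bounds it.\<close>

lemma correct_For:
  assumes IH: "correct m a (insert r A) (r + 2) B p Q"
    and A: "A \<subseteq> {1..m} \<inter> {..<d}" "d \<le> r" "r < m" "s \<in> A"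
  shows "correct m a A d B (For r s p) (B * (Q + [:16:]) + [:4:])"
proof (rule correctI)
  fix x :: "bool list" and h :: nat and w :: "bool list" and \<rho> \<sigma> :: "nat \<Rightarrow> nat" and tgt
  assume *: "a \<longrightarrow> h = 0" "\<forall>r\<in>A. \<rho> r = \<sigma> r \<and> \<sigma> r \<le> poly B (length x)" "\<forall>r\<ge>d. \<rho> r = 0"
    "\<forall>g. tgt = Some g \<longrightarrow> 1 \<le> g \<and> g < d \<and> g \<le> m \<and> g \<notin> A"
  define N where "N = \<sigma> s"
  define q where "q = poly Q (length x)"
  define U where "U j = concat (map (\<lambda>i. out p x (\<sigma>(r := i))) [0..<j])" for j
  have r: "1 \<le> s" "s < r" "s \<le> m" "\<rho> s = N" "\<rho> r = 0" "\<rho> (Suc r) = 0" "r \<notin> A" "Suc r \<notin> A"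
    and N: "N \<le> poly B (length x)"
    using A * by (auto simp: N_def)
  have ne: "tgt \<noteq> Some r'" if "r' \<in> A \<or> d \<le> r'" for r'
    using that *(4) by auto
  have ner: "tgt \<noteq> Some r" "tgt \<noteq> Some (Suc r)" "tgt \<noteq> Some s"
    using A by (auto intro!: ne)

  define S1 where "S1 i = (h, \<rho>(s := N - i, r := i, r + 1 := i), w)" for i
  have 1: "exec m x (While (nonzero s) (Then (dec s) (Then (inc r) (inc (r + 1))))) (S1 0)
    (N * ((1 + (1 + 1)) + 2) + 1) (S1 N)"
  proof (rule exec_while)
    fix i assume "i < N"
    then show "exec m x (Then (dec s) (Then (inc r) (inc (r + 1)))) (S1 i) (1 + (1 + 1)) (S1 (Suc i))"
      unfolding S1_def using r A by (intro exec_cong[OF exec_move2]) (auto simp: fun_eq_iff)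
  qed (use r A in \<open>auto simp: S1_def\<close>)

  define S2 where "S2 i = (h, \<rho>(s := i, r := N - i, r + 1 := N), w)" for i
  have 2: "exec m x (While (nonzero r) (Then (dec r) (inc s))) (S2 0) (N * ((1 + 1) + 2) + 1) (S2 N)"
  proof (rule exec_while)
    fix i assume "i < N"
    then show "exec m x (Then (dec r) (inc s)) (S2 i) (1 + 1) (S2 (Suc i))"
      unfolding S2_def using r A by (intro exec_cong[OF exec_move]) (auto simp: fun_eq_iff)
  qed (use r A in \<open>auto simp: S2_def\<close>)

  have body: "length (out p x (\<sigma>(r := i))) \<le> q"
    "exec m x (compile m tgt p) (h, emit_reg tgt (U i) (\<rho>(r := i, Suc r := j)), emit_word tgt (U i) w) q
     (h, emit_reg tgt (U (Suc i)) (\<rho>(r := i, Suc r := j)), emit_word tgt (U (Suc i)) w)" if "i < N" for i j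
  proof -
    have u: "U (Suc i) = U i @ out p x (\<sigma>(r := i))" by (simp add: U_def)
    let ?\<rho> = "emit_reg tgt (U i) (\<rho>(r := i, Suc r := j))"
    have "\<forall>r'\<in>insert r A. ?\<rho> r' = (\<sigma>(r := i)) r' \<and> (\<sigma>(r := i)) r' \<le> poly B (length x)"
      using r(7,8) ner * ne N \<open>i < N\<close> by auto
    moreover have "\<forall>r'\<ge>r + 2. ?\<rho> r' = 0"
      using A(2) ne * by auto
    moreover have "\<forall>g. tgt = Some g \<longrightarrow> 1 \<le> g \<and> g < r + 2 \<and> g \<le> m \<and> g \<notin> insert r A"
      using *(4) A(2) by auto
    ultimately have "length (out p x (\<sigma>(r := i))) \<le> poly Q (length x)"
      "exec m x (compile m tgt p) (h, ?\<rho>, emit_word tgt (U i) w) (poly Q (length x))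
      (h, emit_reg tgt (out p x (\<sigma>(r := i))) ?\<rho>, emit_word tgt (out p x (\<sigma>(r := i))) (emit_word tgt (U i) w))"
      by (rule correctD[OF IH *(1)])+
    then show "length (out p x (\<sigma>(r := i))) \<le> q"
      "exec m x (compile m tgt p) (h, ?\<rho>, emit_word tgt (U i) w) q
     (h, emit_reg tgt (U (Suc i)) (\<rho>(r := i, Suc r := j)), emit_word tgt (U (Suc i)) w)"
      by (auto simp: u q_def)
  qed

  define S3 where
    "S3 i = (h, emit_reg tgt (U i) (\<rho>(r := i, Suc r := N - i)), emit_word tgt (U i) w)" for i
  have 3: "exec m x (While (nonzero (r + 1)) (Then (dec (r + 1)) (Then (compile m tgt p) (inc r)))) (S3 0)
    (N * ((1 + (q + 1)) + 2) + 1) (S3 N)"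
  proof (rule exec_while)
    fix i assume i: "i < N"
    have "exec m x (dec (r + 1)) (S3 i) 1
        (h, emit_reg tgt (U i) (\<rho>(r := i, Suc r := N - Suc i)), emit_word tgt (U i) w)"
      unfolding S3_def using i A ner by (intro exec_cong[OF exec_dec]) auto
    moreover have "exec m x (inc r)
        (h, emit_reg tgt (U (Suc i)) (\<rho>(r := i, Suc r := N - Suc i)), emit_word tgt (U (Suc i)) w) 1
        (S3 (Suc i))"
      unfolding S3_def using r A ner by (intro exec_cong[OF exec_inc]) (auto simp: fun_upd_twist)
    ultimately show "exec m x (Then (dec (r + 1)) (Then (compile m tgt p) (inc r))) (S3 i)
        (1 + (q + 1)) (S3 (Suc i))"
      using body(2)[OF i] by (intro exec_then)
  qed (use r A ner in \<open>auto simp: S3_def\<close>)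

  have 4: "exec m x (While (nonzero r) (dec r)) (S3 N) (N * (1 + 2) + 1)
    (h, emit_reg tgt (U N) \<rho>, emit_word tgt (U N) w)"
    using exec_clear[of r m x h "emit_reg tgt (U N) (\<rho>(r := N, Suc r := 0))" "emit_word tgt (U N) w"]
      r A ner by (simp add: S3_def fun_upd_idem)

  have S: "S1 0 = (h, \<rho>, w)" "S2 0 = S1 N" "S3 0 = S2 N"
    using r by (auto simp: S1_def S2_def S3_def U_def fun_eq_iff)
  have fin: "exec m x (compile m tgt (For r s p)) (h, \<rho>, w)
     ((N * ((1 + (1 + 1)) + 2) + 1) + ((N * ((1 + 1) + 2) + 1) + ((N * ((1 + (q + 1)) + 2) + 1) + (N * (1 + 2) + 1))))
     (h, emit_reg tgt (U N) \<rho>, emit_word tgt (U N) w)"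
    unfolding compile.simps using 1 2 3 4 unfolding S by (intro exec_then)
  have eq: "(N * ((1 + (1 + 1)) + 2) + 1) + ((N * ((1 + 1) + 2) + 1) + ((N * ((1 + (q + 1)) + 2) + 1) + (N * (1 + 2) + 1)))
      = N * (q + 16) + 4" by (simp add: algebra_simps)
  have le: "N * (q + 16) + 4 \<le> poly (B * (Q + [:16:]) + [:4:]) (length x)"
    using mult_le_mono1[OF N, of "q + 16"] by (simp add: q_def)
  have "length (U j) \<le> j * q" if "j \<le> N" for j
    using that
  proof (induction j)
    case (Suc j)
    with body(1)[of j] show ?case by (simp add: U_def)
  qed (simp add: U_def)
  from this[of N] have len: "length (U N) \<le> N * (q + 16) + 4" by (simp add: algebra_simps)
  have out: "out (For r s p) x \<sigma> = U N" by (simp add: U_def N_def)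
  show "length (out (For r s p) x \<sigma>) \<le> poly (B * (Q + [:16:]) + [:4:]) (length x) \<and>
    exec m x (compile m tgt (For r s p)) (h, \<rho>, w) (poly (B * (Q + [:16:]) + [:4:]) (length x))
     (h, emit_reg tgt (out (For r s p) x \<sigma>) \<rho>, emit_word tgt (out (For r s p) x \<sigma>) w)"
    unfolding out using exec_mono[OF fin[unfolded eq] le] le_trans[OF len le] by blast
qed

text \<open>In the bodies the head may be away from position 0, whence the flag
  \<open>False\<close>, and the index is below the input length, which adds \<open>[:0, 1:]\<close>
  to the bound. With \<open>c\<close> the bound for the bodies, each position costs
  \<open>c + 6\<close> steps forward and \<open>4\<close> back.\<close>

lemma correct_ForIn:
  assumes p: "correct m False (insert r A) (r + 1) (B + [:0, 1:]) p P"
    and q: "correct m False (insert r A) (r + 1) (B + [:0, 1:]) q Q"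
    and A: "A \<subseteq> {1..m} \<inter> {..<d}" "1 \<le> d" "d \<le> r" "r \<le> m" "a"
  shows "correct m a A d B (ForIn r p q) ([:0, 1:] * (P + Q + [:10:]) + [:2:])"
proof (rule correctI)
  fix x :: "bool list" and h :: nat and w :: "bool list" and \<rho> \<sigma> :: "nat \<Rightarrow> nat" and tgt
  assume *: "a \<longrightarrow> h = 0" "\<forall>r\<in>A. \<rho> r = \<sigma> r \<and> \<sigma> r \<le> poly B (length x)" "\<forall>r\<ge>d. \<rho> r = 0"
    "\<forall>g. tgt = Some g \<longrightarrow> 1 \<le> g \<and> g < d \<and> g \<le> m \<and> g \<notin> A"
  define N where "N = length x"
  define c where "c = poly P N + poly Q N"
  define f where "f i = (if x ! i then out p x (\<sigma>(r := i)) else out q x (\<sigma>(r := i)))" for i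
  define U where "U j = concat (map f [0..<j])" for j
  have r: "1 \<le> r" "\<rho> r = 0" "r \<notin> A" and h: "h = 0"
    using A * by auto
  have ne: "tgt \<noteq> Some r'" if "r' \<in> A \<or> d \<le> r'" for r'
    using that *(4) by auto
  have ner: "tgt \<noteq> Some r"
    using A by (auto intro!: ne)

  define S where "S i = (i, emit_reg tgt (U i) (\<rho>(r := i)), emit_word tgt (U i) w)" for i
  have input: "reads m x (S i) ! 0 = (if i < N then if x ! i then 2 else 1 else 0)" for i
    by (simp add: nth_reads S_def word_on_tape_def N_def)
  have body: "length (f i) \<le> c"
    "exec m x (Cond (\<lambda>rs. rs ! 0 = 2) (compile m tgt p) (compile m tgt q)) (S i) (c + 2)
     (i, emit_reg tgt (U (Suc i)) (\<rho>(r := i)), emit_word tgt (U (Suc i)) w)" if "i < N" for i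
  proof -
    have u: "U (Suc i) = U i @ f i" by (simp add: U_def)
    let ?\<rho> = "emit_reg tgt (U i) (\<rho>(r := i))"
    have 1: "\<forall>r'\<in>insert r A. ?\<rho> r' = (\<sigma>(r := i)) r' \<and>
        (\<sigma>(r := i)) r' \<le> poly (B + [:0, 1:]) (length x)"
      using ner r * ne \<open>i < N\<close> by (auto simp: N_def intro: le_add1 trans_le_add1)
    have 2: "\<forall>r'\<ge>r + 1. ?\<rho> r' = 0"
      using A ne * by auto
    have 3: "\<forall>g. tgt = Some g \<longrightarrow> 1 \<le> g \<and> g < r + 1 \<and> g \<le> m \<and> g \<notin> insert r A"
      using *(4) A ner by auto
    have 0: "False \<longrightarrow> i = 0" by simp
    note pc = correctD[OF p, where \<sigma> = "\<sigma>(r := i)" and \<rho> = ?\<rho>, OF 0 1 2 3]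
      and qc = correctD[OF q, where \<sigma> = "\<sigma>(r := i)" and \<rho> = ?\<rho>, OF 0 1 2 3]
    from pc(1) qc(1) show "length (f i) \<le> c" by (auto simp: f_def c_def N_def)
    show "exec m x (Cond (\<lambda>rs. rs ! 0 = 2) (compile m tgt p) (compile m tgt q)) (S i) (c + 2)
     (i, emit_reg tgt (U (Suc i)) (\<rho>(r := i)), emit_word tgt (U (Suc i)) w)"
    proof (rule exec_cond)
      assume "reads m x (S i) ! 0 = 2"
      then have "x ! i" using input[of i] by (auto split: if_splits)
      with exec_mono[OF pc(2)[of "emit_word tgt (U i) w"], of c] show "exec m x (compile m tgt p) (S i) c
       (i, emit_reg tgt (U (Suc i)) (\<rho>(r := i)), emit_word tgt (U (Suc i)) w)"
        by (simp add: S_def u f_def c_def N_def)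
    next
      assume "reads m x (S i) ! 0 \<noteq> 2"
      then have "\<not> x ! i" using input[of i] \<open>i < N\<close> by (auto split: if_splits)
      with exec_mono[OF qc(2)[of "emit_word tgt (U i) w"], of c] show "exec m x (compile m tgt q) (S i) c
       (i, emit_reg tgt (U (Suc i)) (\<rho>(r := i)), emit_word tgt (U (Suc i)) w)"
        by (simp add: S_def u f_def c_def N_def)
    qed
  qed

  have 1: "exec m x (While (\<lambda>rs. rs ! 0 \<noteq> 0)
      (Then (Cond (\<lambda>rs. rs ! 0 = 2) (compile m tgt p) (compile m tgt q)) (Then (inc 0) (inc r)))) (S 0)
    (N * (((c + 2) + (1 + 1)) + 2) + 1) (S N)"
  proof (rule exec_while)
    fix i assume i: "i < N"
    have "exec m x (inc r)
        (Suc i, emit_reg tgt (U (Suc i)) (\<rho>(r := i)), emit_word tgt (U (Suc i)) w) 1 (S (Suc i))"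
      unfolding S_def using r A ner by (intro exec_cong[OF exec_inc]) auto
    with body(2)[OF i] show "exec m x (Then (Cond (\<lambda>rs. rs ! 0 = 2) (compile m tgt p) (compile m tgt q))
        (Then (inc 0) (inc r))) (S i) ((c + 2) + (1 + 1)) (S (Suc i))"
      by (intro exec_then) (assumption | rule exec_input_right)+
  qed (auto simp: input)

  define S' where "S' i = (N - i, emit_reg tgt (U N) (\<rho>(r := N - i)), emit_word tgt (U N) w)" for i
  have 2: "exec m x (While (nonzero r) (Then (dec r) (dec 0))) (S' 0) (N * ((1 + 1) + 2) + 1) (S' N)"
  proof (rule exec_while)
    fix i assume i: "i < N"
    have "exec m x (dec r) (S' i) 1 (N - i, emit_reg tgt (U N) (\<rho>(r := N - Suc i)), emit_word tgt (U N) w)"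
      unfolding S'_def using i r A ner by (intro exec_cong[OF exec_dec]) auto
    moreover have "exec m x (dec 0) (N - i, emit_reg tgt (U N) (\<rho>(r := N - Suc i)), emit_word tgt (U N) w)
        1 (S' (Suc i))"
      unfolding S'_def using i by (intro exec_cong[OF exec_input_left]) auto
    ultimately show "exec m x (Then (dec r) (dec 0)) (S' i) (1 + 1) (S' (Suc i))"
      by (rule exec_then)
  qed (use r A ner in \<open>auto simp: S'_def\<close>)

  have S: "S 0 = (h, \<rho>, w)" "S' 0 = S N" "S' N = (h, emit_reg tgt (U N) \<rho>, emit_word tgt (U N) w)"
    using r h by (auto simp: S_def S'_def U_def fun_eq_iff fun_upd_idem)
  have "exec m x (compile m tgt (ForIn r p q)) (h, \<rho>, w)
     ((N * (((c + 2) + (1 + 1)) + 2) + 1) + (N * ((1 + 1) + 2) + 1))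
     (h, emit_reg tgt (U N) \<rho>, emit_word tgt (U N) w)"
    unfolding compile.simps using 1 2 unfolding S by (intro exec_then)
  moreover have "(N * (((c + 2) + (1 + 1)) + 2) + 1) + (N * ((1 + 1) + 2) + 1)
      = poly ([:0, 1:] * (P + Q + [:10:]) + [:2:]) (length x)" by (simp add: algebra_simps c_def N_def)
  moreover have "length (U j) \<le> j * c" if "j \<le> N" for j
    using that
  proof (induction j)
    case (Suc j)
    with body(1)[of j] show ?case by (simp add: U_def)
  qed (simp add: U_def)
  then have "length (U N) \<le> poly ([:0, 1:] * (P + Q + [:10:]) + [:2:]) (length x)"
    using le_trans[of "length (U N)" "N * c"] by (simp add: algebra_simps c_def N_def)
  moreover have "U N = out (ForIn r p q) x \<sigma>" by (simp add: U_def f_def[abs_def] N_def)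
  ultimately show "length (out (ForIn r p q) x \<sigma>) \<le> poly ([:0, 1:] * (P + Q + [:10:]) + [:2:]) (length x) \<and>
    exec m x (compile m tgt (ForIn r p q)) (h, \<rho>, w) (poly ([:0, 1:] * (P + Q + [:10:]) + [:2:]) (length x))
     (h, emit_reg tgt (out (ForIn r p q) x \<sigma>) \<rho>, emit_word tgt (out (ForIn r p q) x \<sigma>) w)"
    by (simp only:)
qed

text \<open>Compiling \<open>p\<close> with target \<open>r\<close> leaves the length of its output
  in \<open>r\<close>, so the readable registers of \<open>q\<close> are bounded by
  \<open>B + P\<close>. The last summand of the time pays for clearing \<open>r\<close>.\<close>

lemma correct_LetLen:
  assumes p: "correct m a A (r + 1) B p P"
    and q: "correct m a (insert r A) (r + 1) (B + P) q Q"
    and A: "A \<subseteq> {1..m} \<inter> {..<d}" "1 \<le> d" "d \<le> r" "r \<le> m"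
  shows "correct m a A d B (LetLen r p q) (P + (Q + (P * [:3:] + [:1:])))"
proof (rule correctI)
  fix x :: "bool list" and h :: nat and w :: "bool list" and \<rho> \<sigma> :: "nat \<Rightarrow> nat" and tgt
  assume *: "a \<longrightarrow> h = 0" "\<forall>r\<in>A. \<rho> r = \<sigma> r \<and> \<sigma> r \<le> poly B (length x)" "\<forall>r\<ge>d. \<rho> r = 0"
    "\<forall>g. tgt = Some g \<longrightarrow> 1 \<le> g \<and> g < d \<and> g \<le> m \<and> g \<notin> A"
  define l where "l = length (out p x \<sigma>)"
  let ?u = "out q x (\<sigma>(r := l))"
  have r: "1 \<le> r" "\<rho> r = 0" "r \<notin> A" "tgt \<noteq> Some r"
    using A * by auto
  have "\<forall>r'\<ge>r + 1. \<rho> r' = 0" "\<forall>g. Some r = Some g \<longrightarrow> 1 \<le> g \<and> g < r + 1 \<and> g \<le> m \<and> g \<notin> A"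
    using A r * by auto
  note pc = correctD[OF p *(1,2) this]
  have "\<forall>r'\<in>insert r A. (\<rho>(r := l)) r' = (\<sigma>(r := l)) r' \<and> (\<sigma>(r := l)) r' \<le> poly (B + P) (length x)"
    "\<forall>r'\<ge>r + 1. (\<rho>(r := l)) r' = 0"
    "\<forall>g. tgt = Some g \<longrightarrow> 1 \<le> g \<and> g < r + 1 \<and> g \<le> m \<and> g \<notin> insert r A"
    using A r * pc(1) by (auto simp: l_def intro: trans_le_add1 trans_le_add2)
  note qc = correctD[OF q, where \<sigma> = "\<sigma>(r := l)" and \<rho> = "\<rho>(r := l)", OF *(1) this]
  have "exec m x (compile m (Some r) p) (h, \<rho>, w) (poly P (length x)) (h, \<rho>(r := l), w)"
    using pc(2) r by (simp add: l_def)
  moreover have "exec m x (While (nonzero r) (dec r))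
      (h, emit_reg tgt ?u (\<rho>(r := l)), emit_word tgt ?u w) (poly P (length x) * 3 + 1)
      (h, emit_reg tgt ?u \<rho>, emit_word tgt ?u w)"
    using exec_mono[OF exec_clear[of r m x h "emit_reg tgt ?u (\<rho>(r := l))" "emit_word tgt ?u w"]] r A pc(1)
    by (simp add: fun_upd_idem l_def)
  ultimately have "exec m x (compile m tgt (LetLen r p q)) (h, \<rho>, w)
      (poly P (length x) + (poly Q (length x) + (poly P (length x) * 3 + 1)))
      (h, emit_reg tgt ?u \<rho>, emit_word tgt ?u w)"
    unfolding compile.simps using qc(2) by (intro exec_then)
  with qc(1) show "length (out (LetLen r p q) x \<sigma>) \<le> poly (P + (Q + (P * [:3:] + [:1:]))) (length x) \<and>
    exec m x (compile m tgt (LetLen r p q)) (h, \<rho>, w) (poly (P + (Q + (P * [:3:] + [:1:]))) (length x))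
     (h, emit_reg tgt (out (LetLen r p q) x \<sigma>) \<rho>, emit_word tgt (out (LetLen r p q) x \<sigma>) w)"
    by (simp add: l_def mult.commute)
qed

text \<open>Moving the minimum of the two registers into \<open>y\<close> and back costs
  \<open>5\<close> steps per unit each way, whence \<open>10\<close>; the \<open>4\<close> collects
  two failing loop tests and the overhead of \<open>Cond\<close>.\<close>

lemma correct_IfEq:
  assumes p: "correct m a A d B p P" and q: "correct m a A d B q Q"
    and A: "A \<subseteq> {1..m} \<inter> {..<d}" "1 \<le> d" "d \<le> y" "y \<le> m" "r \<in> A" "s \<in> A" "r \<noteq> s"
  shows "correct m a A d B (IfEq y r s p q) (P + Q + B * [:10:] + [:4:])"
proof (rule correctI)
  fix x :: "bool list" and h :: nat and w :: "bool list" and \<rho> \<sigma> :: "nat \<Rightarrow> nat" and tgt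
  assume *: "a \<longrightarrow> h = 0" "\<forall>r\<in>A. \<rho> r = \<sigma> r \<and> \<sigma> r \<le> poly B (length x)" "\<forall>r\<ge>d. \<rho> r = 0"
    "\<forall>g. tgt = Some g \<longrightarrow> 1 \<le> g \<and> g < d \<and> g \<le> m \<and> g \<notin> A"
  define N where "N = min (\<sigma> r) (\<sigma> s)"
  let ?b = "poly B (length x)" and ?c = "poly P (length x) + poly Q (length x)"
  have y: "r \<noteq> y" "s \<noteq> y"
    using A by auto
  have r: "\<rho> y = 0" "\<rho> r = \<sigma> r" "\<rho> s = \<sigma> s" "distinct [r, s, y]" "{r, s, y} \<subseteq> {1..m}"
    using A(1-6) A(7) *(2,3) y by (simp_all add: subset_eq)
  have N: "N \<le> \<sigma> r" "N \<le> \<sigma> s" "N \<le> ?b"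
    using A(5) *(2) by (auto simp: N_def intro: min.coboundedI1)
  define S where "S i = (h, \<rho>(r := \<sigma> r - i, s := \<sigma> s - i, y := i), w)" for i
  have 1: "exec m x (While (\<lambda>rs. nonzero r rs \<and> nonzero s rs) (Then (dec r) (Then (dec s) (inc y))))
     (S 0) (N * ((1 + (1 + 1)) + 2) + 1) (S N)"
  proof (rule exec_while)
    fix i assume "i < N"
    then show "exec m x (Then (dec r) (Then (dec s) (inc y))) (S i) (1 + (1 + 1)) (S (Suc i))"
      unfolding S_def using r N by (intro exec_cong[OF exec_move_from2]) (auto simp: fun_eq_iff)
  qed (use r N in \<open>auto simp: S_def N_def min_def\<close>)

  define S' where "S' i = (h, \<rho>(r := \<sigma> r - N + i, s := \<sigma> s - N + i, y := N - i), w)" for i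
  have 2: "exec m x (While (nonzero y) (Then (dec y) (Then (inc r) (inc s))))
     (S' 0) (N * ((1 + (1 + 1)) + 2) + 1) (S' N)"
  proof (rule exec_while)
    fix i assume "i < N"
    then show "exec m x (Then (dec y) (Then (inc r) (inc s))) (S' i) (1 + (1 + 1)) (S' (Suc i))"
      unfolding S'_def using r by (intro exec_cong[OF exec_move2]) (auto simp: fun_eq_iff)
  qed (use r in \<open>auto simp: S'_def\<close>)

  let ?u = "out (IfEq y r s p q) x \<sigma>"
  have S: "S 0 = (h, \<rho>, w)" "S' 0 = S N" "S' N = (h, \<rho>, w)"
    using r N by (auto simp: S_def S'_def fun_eq_iff)
  have guard: "nonzero r (reads m x (S N)) \<or> nonzero s (reads m x (S N)) \<longleftrightarrow> \<sigma> r \<noteq> \<sigma> s"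
    using r by (auto simp: S_def N_def min_def)
  note pc = correctD[OF p *] and qc = correctD[OF q *]
  have "exec m x (Cond (\<lambda>rs. nonzero r rs \<or> nonzero s rs)
      (Then (While (nonzero y) (Then (dec y) (Then (inc r) (inc s)))) (compile m tgt q))
      (Then (While (nonzero y) (Then (dec y) (Then (inc r) (inc s)))) (compile m tgt p))) (S N)
      (((N * ((1 + (1 + 1)) + 2) + 1) + ?c) + 2) (h, emit_reg tgt ?u \<rho>, emit_word tgt ?u w)"
  proof (rule exec_cond)
    assume "nonzero r (reads m x (S N)) \<or> nonzero s (reads m x (S N))"
    then have "exec m x (compile m tgt q) (S' N) ?c (h, emit_reg tgt ?u \<rho>, emit_word tgt ?u w)"
      unfolding guard S using exec_mono[OF qc(2)] by simp
    with 2 show "exec m x (Then (While (nonzero y) (Then (dec y) (Then (inc r) (inc s)))) (compile m tgt q)) (S N)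
      ((N * ((1 + (1 + 1)) + 2) + 1) + ?c) (h, emit_reg tgt ?u \<rho>, emit_word tgt ?u w)"
      unfolding S by (rule exec_then)
  next
    assume "\<not> (nonzero r (reads m x (S N)) \<or> nonzero s (reads m x (S N)))"
    then have "exec m x (compile m tgt p) (S' N) ?c (h, emit_reg tgt ?u \<rho>, emit_word tgt ?u w)"
      unfolding guard S using exec_mono[OF pc(2)] by simp
    with 2 show "exec m x (Then (While (nonzero y) (Then (dec y) (Then (inc r) (inc s)))) (compile m tgt p)) (S N)
      ((N * ((1 + (1 + 1)) + 2) + 1) + ?c) (h, emit_reg tgt ?u \<rho>, emit_word tgt ?u w)"
      unfolding S by (rule exec_then)
  qed
  with 1 have "exec m x (compile m tgt (IfEq y r s p q)) (h, \<rho>, w)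
      ((N * ((1 + (1 + 1)) + 2) + 1) + (((N * ((1 + (1 + 1)) + 2) + 1) + ?c) + 2))
      (h, emit_reg tgt ?u \<rho>, emit_word tgt ?u w)"
    unfolding compile.simps S by (rule exec_then)
  moreover have "(N * ((1 + (1 + 1)) + 2) + 1) + (((N * ((1 + (1 + 1)) + 2) + 1) + ?c) + 2)
      \<le> poly (P + Q + B * [:10:] + [:4:]) (length x)"
    using N(3) by simp
  ultimately have "exec m x (compile m tgt (IfEq y r s p q)) (h, \<rho>, w)
      (poly (P + Q + B * [:10:] + [:4:]) (length x)) (h, emit_reg tgt ?u \<rho>, emit_word tgt ?u w)"
    by (rule exec_mono)
  moreover have "length ?u \<le> poly (P + Q + B * [:10:] + [:4:]) (length x)"
    using pc(1) qc(1) by simp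
  ultimately show "length ?u \<le> poly (P + Q + B * [:10:] + [:4:]) (length x) \<and>
    exec m x (compile m tgt (IfEq y r s p q)) (h, \<rho>, w) (poly (P + Q + B * [:10:] + [:4:]) (length x))
     (h, emit_reg tgt ?u \<rho>, emit_word tgt ?u w)" by blast
qed

text \<open>\<open>B\<close> is generalised because the bound on readable registers grows at every
  \<open>ForIn\<close> and \<open>LetLen\<close>. It grows along the fixed program text, not with
  the input, and therefore stays polynomial.\<close>

lemma correct_prog:
  "wf_prog m a A d p \<Longrightarrow> A \<subseteq> {1..m} \<inter> {..<d} \<Longrightarrow> 1 \<le> d \<Longrightarrow> \<exists>Q. correct m a A d B p Q"
proof (induction p arbitrary: a A d B)
  case (Emit u)
  show ?case using correct_Emit by blast
next
  case (Seq p q)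
  then show ?case using correct_Seq by (metis wf_prog.simps(2))
next
  case (For r s p)
  then obtain Q where "correct m a (insert r A) (r + 2) B p Q"
    using For.IH[of a "insert r A" "r + 2" B] by fastforce
  with For.prems show ?case using correct_For[of m a r A B p Q d s] by auto
next
  case (ForIn r p q)
  from ForIn.prems obtain P where "correct m False (insert r A) (r + 1) (B + [:0, 1:]) p P"
    using ForIn.IH(1)[of False "insert r A" "r + 1" "B + [:0, 1:]"] by fastforce
  moreover from ForIn.prems obtain Q where "correct m False (insert r A) (r + 1) (B + [:0, 1:]) q Q"
    using ForIn.IH(2)[of False "insert r A" "r + 1" "B + [:0, 1:]"] by fastforce
  ultimately show ?case using correct_ForIn[of m r A B p P q Q d a] ForIn.prems by auto
next
  case (LetLen r p q)
  from LetLen.prems obtain P where "correct m a A (r + 1) B p P"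
    using LetLen.IH(1)[of a A "r + 1" B] by fastforce
  moreover from LetLen.prems obtain Q where "correct m a (insert r A) (r + 1) (B + P) q Q"
    using LetLen.IH(2)[of a "insert r A" "r + 1" "B + P"] by fastforce
  ultimately show ?case using correct_LetLen[of m a A r B p P q Q d] LetLen.prems by auto
next
  case (IfEq y r s p q)
  from IfEq.prems obtain P Q where "correct m a A d B p P" "correct m a A d B q Q"
    using IfEq.IH by (metis wf_prog.simps(6))
  then show ?case using correct_IfEq[of m a A d B p P q Q y r s] IfEq.prems by auto
qed

section \<open>Initialising the register tapes\<close>

primrec mark_tapes :: "nat \<Rightarrow> cmd" where
  "mark_tapes 0 = skip"
| "mark_tapes (Suc i) = Then (mark_tapes i) (Act (Suc i) (Some 1) Stay)"

lemma runs_mark_tapes: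
  assumes "i \<le> m"
  shows "runs (m + 2) (mark_tapes i) (snd (init_config (m + 2) x)) (i + 1)
    (map (\<lambda>j. if j = 0 then (0, word_on_tape x) else (0, if j \<le> i then (word_on_tape [])(0 := 1) else word_on_tape []))
      [0..<m + 2])"
proof -
  define T :: "nat \<Rightarrow> nat \<Rightarrow> tape" where "T i j = (if j = 0 then (0, word_on_tape x)
    else (0, if j \<le> i then (word_on_tape [])(0 := 1) else word_on_tape [] :: int \<Rightarrow> nat))" for i j :: nat
  have "read_tape (T i j) \<in> {0, 1, 2}" for i j
    by (simp add: T_def word_on_tape_def)
  then have "set (map read_tape (map (T i) [0..<m + 2])) \<subseteq> {0, 1, 2}" for i
    unfolding set_map by (intro image_subsetI) (erule imageE, simp only:)
  then have reads: "map read_tape (map (T i) [0..<m + 2]) \<in> vecs (m + 2)" for i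
    unfolding vecs_def by (simp del: upt_Suc)
  from assms have "runs (m + 2) (mark_tapes i) (snd (init_config (m + 2) x)) (i + 1) (map (T i) [0..<m + 2])"
  proof (induction i)
    case 0
    have "snd (init_config (m + 2) x) = map (T 0) [0..<m + 2]"
      by (rule nth_equalityI) (auto simp: init_config_def nth_Cons' T_def simp del: upt_Suc)
    then show ?case using runs_act[OF reads[of 0], of 0 None Stay]
      by (simp add: list_update_map_upt del: upt_Suc)
  next
    case (Suc i)
    have "runs (m + 2) (Act (Suc i) (Some 1) Stay) (map (T i) [0..<m + 2]) 1
       ((map (T i) [0..<m + 2])[Suc i := act_tape (1, Stay) (map (T i) [0..<m + 2] ! Suc i)])"
      using runs_act[OF reads[of i], of "Suc i" "Some 1" Stay] Suc.prems by simp
    also have "map (T i) [0..<m + 2] ! Suc i = T i (Suc i)"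
      using Suc.prems by (simp del: upt_Suc)
    also have "(map (T i) [0..<m + 2])[Suc i := act_tape (1, Stay) (T i (Suc i))] = map (T (Suc i)) [0..<m + 2]"
      unfolding list_update_map_upt by (intro map_cong) (auto simp: T_def)
    finally have "runs (m + 2) (Then (mark_tapes i) (Act (Suc i) (Some 1) Stay))
        (snd (init_config (m + 2) x)) (i + 1 + 1) (map (T (Suc i)) [0..<m + 2])"
      using Suc by (intro runs_then) simp_all
    then show ?case by (simp del: upt_Suc)
  qed
  then show ?thesis by (simp only: T_def[abs_def])
qed

lemma polytime_computable_out:
  assumes "wf_prog m True {1} 2 p" "1 \<le> m"
  shows "polytime_computable (\<lambda>x. out p x (\<lambda>_. 0))"
proof -
  from assms obtain Q where Q: "correct m True {1} 2 [:0:] p Q"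
    using correct_prog[of m True "{1}" 2 p "[:0:]"] by auto
  define c where "c = Then (mark_tapes m) (compile m None p)"
  have "\<exists>t\<le>poly ([:m + 1:] + Q) (length x). \<exists>q ts.
       (init_config (m + 2) x, q, ts) \<in> step (tm (m + 2) c 0) ^^ t \<and>
       (q, ts) \<notin> Domain (step (tm (m + 2) c 0)) \<and>
       snd (last ts) = word_on_tape (out p x (\<lambda>_. 0))" for x
  proof -
    let ?u = "out p x (\<lambda>_. 0)"
    have "exec m x (compile m None p) (0, \<lambda>_. 0, []) (poly Q (length x)) (0, \<lambda>_. 0, ?u)"
      using correctD(2)[OF Q, of 0 "\<lambda>_. 0" "\<lambda>_. 0" x None "[]"] by simp
    moreover have "rep m x (0, \<lambda>_. 0, []) = map (\<lambda>j. if j = 0 then (0, word_on_tape x)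
        else (0, if j \<le> m then (word_on_tape [])(0 := 1) else word_on_tape [])) [0..<m + 2]"
      unfolding rep_def by (intro map_cong) auto
    ultimately have "runs (m + 2) c (snd (init_config (m + 2) x)) (m + 1 + poly Q (length x))
        (rep m x (0, \<lambda>_. 0, ?u))"
      unfolding c_def exec_def using runs_mark_tapes[of m m x] by (intro runs_then) auto
    then obtain t where t: "t \<le> m + 1 + poly Q (length x)"
      "run (m + 2) c (snd (init_config (m + 2) x)) t (rep m x (0, \<lambda>_. 0, ?u))"
      by (auto simp: runs_def)
    have "(init_config (m + 2) x, len c, rep m x (0, \<lambda>_. 0, ?u)) \<in> step (tm (m + 2) c 0) ^^ t"
      using run_tm[OF t(2) subset_refl, of 0] by (simp add: init_config_def)
    \<comment> \<open>The machine halts here because the exit state of the outermost block carries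
      no transition.\<close>
    moreover have "(len c, rep m x (0, \<lambda>_. 0, ?u)) \<notin> Domain (step (tm (m + 2) c 0))"
      unfolding step_def using source_tm[of "len c" _ _ "m + 2" c 0] by auto
    moreover have "snd (last (rep m x (0, \<lambda>_. 0, ?u))) = word_on_tape ?u"
      by (simp add: rep_def)
    ultimately show ?thesis using t(1) by (intro exI[of _ t]) auto
  qed
  moreover have "turing_machine (m + 2) (tm (m + 2) c 0)"
    unfolding turing_machine_def using finite_tm length_tm by fastforce
  ultimately show ?thesis
    unfolding polytime_computable_def using single_valued_tm by blast
qed


section \<open>Tableaux of nondeterministic machines\<close>

type_synonym transition = "(nat \<times> nat list) \<times> (nat \<times> (nat \<times> move) list)"

text \<open>The transition is stored in every cell of its row and not only under the heads, because
  every cell has to know how its symbols shift. \<open>center\<close> marks offset 0, where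
  \<open>tiles\<close> requires the symbols to be those that the transition reads.\<close>

datatype tile = Tile (ctrl: "transition option") (center: bool) (syms: "nat list")

definition symbols :: "transitions \<Rightarrow> nat set" where
  "symbols \<Delta> = {0, 1, 2} \<union> (\<Union>(c, q, as) \<in> \<Delta>. fst ` set as)"

definition tiles :: "nat \<Rightarrow> transitions \<Rightarrow> tile set" where
  "tiles k \<Delta> = {Tile c b s | c b s. c \<in> insert None (Some ` \<Delta>) \<and> set s \<subseteq> symbols \<Delta> \<and> length s = k \<and>
     (\<forall>tr. b \<longrightarrow> c = Some tr \<longrightarrow> s = snd (fst tr))}"

text \<open>
  A cell without transition belongs to a row after acceptance, where the symbols are arbitrary. \<open>vert\<close>
  relates a cell at offset \<open>z + d\<close> to the cell at offset \<open>z\<close> in the next row.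
\<close>

definition vert :: "nat \<Rightarrow> int \<Rightarrow> tile \<Rightarrow> tile \<Rightarrow> bool" where
  "vert k d A B \<longleftrightarrow> (case ctrl A of
     None \<Rightarrow> ctrl B = None
   | Some (c, q', as) \<Rightarrow> (case ctrl B of
       None \<Rightarrow> q' = 1
     | Some tr \<Rightarrow> fst (fst tr) = q' \<and> (\<forall>j<k. move_head (snd (as ! j)) 0 = d \<longrightarrow>
         syms B ! j = (if center A then fst (as ! j) else syms A ! j))))"

definition initial :: "nat \<Rightarrow> nat \<Rightarrow> tile \<Rightarrow> bool" where
  "initial k s A \<longleftrightarrow> (\<exists>tr. ctrl A = Some tr \<and> fst (fst tr) = 0) \<and> syms A = s # replicate (k - 1) 0"

text \<open>The columns stand for the offsets from \<open>- T\<close> to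
  \<open>T + length x\<close>. On the first tape, row 0 thus consists of \<open>T\<close> blanks,
  the whole input and \<open>T + 1\<close> blanks, whichever of \<open>T\<close> and
  \<open>length x\<close> is larger. The last condition expresses acceptance within \<open>T\<close>
  steps.\<close>

definition tableau :: "nat \<Rightarrow> transitions \<Rightarrow> nat \<Rightarrow> bool list \<Rightarrow> (nat \<Rightarrow> nat \<Rightarrow> tile) \<Rightarrow> bool" where
  "tableau k \<Delta> T x g \<longleftrightarrow>
     (\<forall>t\<le>T. \<forall>i<T + length x + Suc T.
        g t i \<in> tiles k \<Delta> \<and> (center (g t i) \<longleftrightarrow> i = T) \<and>
        (Suc i < T + length x + Suc T \<longrightarrow> ctrl (g t i) = ctrl (g t (Suc i))) \<and>
        (t < T \<longrightarrow> vert k 0 (g t i) (g (Suc t) i) \<and>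
          (Suc i < T + length x + Suc T \<longrightarrow>
             vert k 1 (g t (Suc i)) (g (Suc t) i) \<and> vert k (-1) (g t i) (g (Suc t) (Suc i)))) \<and>
        (t = 0 \<longrightarrow> initial k (word_on_tape x (int i - int T)) (g t i)) \<and>
        (t = T \<longrightarrow> ctrl (g t i) = None))"

lemma finite_tiles:
  assumes "finite \<Delta>"
  shows "finite (tiles k \<Delta>)"
proof -
  have "finite (symbols \<Delta>)" using assms by (auto simp: symbols_def)
  then have "finite {s. set s \<subseteq> symbols \<Delta> \<and> length s = k}" by (rule finite_lists_length_eq)
  then have "finite ((\<lambda>(c, b, s). Tile c b s) `
      (insert None (Some ` \<Delta>) \<times> UNIV \<times> {s. set s \<subseteq> symbols \<Delta> \<and> length s = k}))"
    using assms by (intro finite_imageI finite_cartesian_product) auto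
  then show ?thesis
  proof (rule rev_finite_subset, intro subsetI)
    fix A assume "A \<in> tiles k \<Delta>"
    then show "A \<in> (\<lambda>(c, b, s). Tile c b s) `
      (insert None (Some ` \<Delta>) \<times> UNIV \<times> {s. set s \<subseteq> symbols \<Delta> \<and> length s = k})"
      unfolding tiles_def by (intro image_eqI[of _ _ "(ctrl A, center A, syms A)"]) auto
  qed
qed

lemma tableau_row:
  assumes "tableau k \<Delta> T x g" "t \<le> T" "i < T + length x + Suc T"
  shows "ctrl (g t i) = ctrl (g t T)"
proof -
  have "ctrl (g t i) = ctrl (g t 0)" if "i < T + length x + Suc T" for i
    using that
  proof (induction i)
    case (Suc i)
    moreover have "ctrl (g t i) = ctrl (g t (Suc i))"
      using assms(1,2) Suc.prems unfolding tableau_def by auto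
    ultimately show ?case by simp
  qed simp
  from this[of i] this[of T] assms(3) show ?thesis by simp
qed

lemma tableau_vert:
  assumes "tableau k \<Delta> T x g" "t < T" "\<bar>z\<bar> \<le> int T - int (Suc t)"
  shows "vert k (move_head m 0) (g t (nat (int T + z + move_head m 0))) (g (Suc t) (nat (int T + z)))"
proof -
  have v: "vert k 0 (g t i) (g (Suc t) i)" if "i < T + length x + Suc T" for i
    using assms(1,2) that unfolding tableau_def by auto
  have w: "vert k 1 (g t (Suc i)) (g (Suc t) i) \<and> vert k (-1) (g t i) (g (Suc t) (Suc i))"
    if "Suc i < T + length x + Suc T" for i
    using assms(1,2) that unfolding tableau_def by auto
  show ?thesis
  proof (cases m)
    case Move_Left
    define i where "i = nat (int T + z - 1)"
    have "nat (int T + z) = Suc i" "Suc i < T + length x + Suc T"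
      using assms(2,3) by (auto simp: i_def)
    with w[of i] show ?thesis by (simp add: Move_Left i_def)
  next
    case Stay
    with v[of "nat (int T + z)"] assms(2,3) show ?thesis by auto
  next
    case Move_Right
    define i where "i = nat (int T + z)"
    have "nat (int T + z + 1) = Suc i" "Suc i < T + length x + Suc T"
      using assms(2,3) by (auto simp: i_def)
    with w[of i] show ?thesis by (simp add: Move_Right i_def)
  qed
qed

text \<open>The change of coordinates behind \<open>vert\<close>: if the head moves by
  \<open>d\<close>, offset \<open>z\<close> from its new position is offset \<open>z + d\<close>
  from the old one, and the freshly written symbol is met where \<open>z + d = 0\<close>.\<close>

lemma snd_act_tape:
  "snd (act_tape (s, m) (h, w)) (fst (act_tape (s, m) (h, w)) + z) =
     (if z + move_head m 0 = 0 then s else w (h + (z + move_head m 0)))"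
  by (cases m) (auto simp: algebra_simps)

text \<open>The run is read off row by row, but row \<open>t\<close> is trusted only at offsets up
  to \<open>T - t\<close>: border cells may lack the neighbour from which their symbols should come,
  and the damage spreads by one column per step. Offset 0 stays inside this cone to the end, so the
  symbols read by the heads are always right.\<close>

lemma accepts_if_tableau:
  assumes "turing_machine k \<Delta>" "tableau k \<Delta> T x g"
  shows "accepts_within k \<Delta> T x"
proof -
  define n where "n = T + length x + Suc T"
  have k: "k \<ge> 1" using assms(1) by (simp add: turing_machine_def)
  have tab: "g t i \<in> tiles k \<Delta>" "center (g t i) \<longleftrightarrow> i = T"
    "t = 0 \<Longrightarrow> initial k (word_on_tape x (int i - int T)) (g t i)"
    "t = T \<Longrightarrow> ctrl (g t i) = None" if "t \<le> T" "i < n" for t i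
    using assms(2) that unfolding tableau_def n_def by auto
  define reach where "reach t q ts \<longleftrightarrow> (init_config k x, (q, ts)) \<in> step \<Delta> ^^ t \<and> length ts = k \<and>
     (case ctrl (g t T) of
        None \<Rightarrow> q = 1
      | Some tr \<Rightarrow> q = fst (fst tr) \<and> (\<forall>j<k. \<forall>z. \<bar>z\<bar> \<le> int T - int t \<longrightarrow>
          snd (ts ! j) (fst (ts ! j) + z) = syms (g t (nat (int T + z))) ! j))" for t q ts
  \<comment> \<open>Rows are followed up to the first one without transition; there
    \<open>reach\<close> says that the state is accepting.\<close>
  have *: "\<exists>q ts. reach t q ts" if "t \<le> T" "\<forall>s<t. ctrl (g s T) \<noteq> None" for t
    using that
  proof (induction t)
    case 0
    define ts where "ts = snd (init_config k x)"
    have ts: "init_config k x = (0, ts)" "length ts = k"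
      using k by (auto simp: ts_def init_config_def)
    obtain tr where tr: "ctrl (g 0 T) = Some tr" "fst (fst tr) = 0"
      using tab(3)[of 0 T] by (auto simp: initial_def n_def)
    have "snd (ts ! j) (fst (ts ! j) + z) = syms (g 0 (nat (int T + z))) ! j"
      if "j < k" "\<bar>z\<bar> \<le> int T" for j z
    proof -
      have "syms (g 0 (nat (int T + z))) = word_on_tape x z # replicate (k - 1) 0"
        using tab(3)[of 0 "nat (int T + z)"] that(2) by (auto simp: initial_def n_def)
      then show ?thesis using that(1)
        by (cases j) (auto simp: ts_def init_config_def word_on_tape_def)
    qed
    then have "reach 0 0 ts" using ts tr by (simp add: reach_def)
    then show ?case by blast
  next
    case (Suc t)
    then obtain q ts where R: "reach t q ts" by auto
    obtain p rs q' as where c: "ctrl (g t T) = Some ((p, rs), q', as)"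
      using Suc.prems(2) by (cases "ctrl (g t T)") auto
    from R have r: "(init_config k x, (q, ts)) \<in> step \<Delta> ^^ t" "length ts = k" "q = p"
      "\<And>j z. j < k \<Longrightarrow> \<bar>z\<bar> \<le> int T - int t \<Longrightarrow>
          snd (ts ! j) (fst (ts ! j) + z) = syms (g t (nat (int T + z))) ! j"
      unfolding reach_def c option.case fst_conv by blast+
    have t: "t < T" using Suc.prems by simp
    have tile: "g t T \<in> tiles k \<Delta>" "center (g t T)"
      using tab(1,2)[of t T] t by (auto simp: n_def)
    with c have \<Delta>: "((p, rs), q', as) \<in> \<Delta>" and rs: "syms (g t T) = rs" "length rs = k"
      by (auto simp: tiles_def)
    have as: "length as = k" using assms(1) \<Delta> unfolding turing_machine_def by fastforce
    have "map read_tape ts = rs"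
    proof (rule nth_equalityI)
      fix j assume "j < length (map read_tape ts)"
      then show "map read_tape ts ! j = rs ! j"
        using r(4)[of j 0] t r(2) rs by (cases "ts ! j") auto
    qed (simp add: r rs)
    with \<Delta> r(3) have "((q, ts), (q', map2 act_tape as ts)) \<in> step \<Delta>"
      unfolding step_def by auto
    with r(1) have reach': "(init_config k x, (q', map2 act_tape as ts)) \<in> step \<Delta> ^^ Suc t"
      by auto
    have vert: "vert k (move_head m 0) (g t (nat (int T + z + move_head m 0))) (g (Suc t) (nat (int T + z)))"
      if "\<bar>z\<bar> \<le> int T - int (Suc t)" for m z
      using tableau_vert[OF assms(2) t that] .
    have row: "ctrl (g s (nat (int T + z))) = ctrl (g s T)" if "\<bar>z\<bar> \<le> int T" "s \<le> T" for s z
      using tableau_row[OF assms(2), of s "nat (int T + z)"] that by auto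
    show ?case
    proof (cases "ctrl (g (Suc t) T)")
      case None
      with vert[of 0 Stay] t c have "q' = 1" by (simp add: vert_def)
      with None reach' r(2) as have "reach (Suc t) q' (map2 act_tape as ts)"
        unfolding reach_def by simp
      then show ?thesis by blast
    next
      case (Some tr)
      with vert[of 0 Stay] t c have q': "fst (fst tr) = q'" by (simp add: vert_def)
      have "snd (map2 act_tape as ts ! j) (fst (map2 act_tape as ts ! j) + z) =
          syms (g (Suc t) (nat (int T + z))) ! j"
        if j: "j < k" and z: "\<bar>z\<bar> \<le> int T - int (Suc t)" for j z
      proof -
        obtain s m where sm: "as ! j = (s, m)" by fastforce
        obtain h w where hw: "ts ! j = (h, w)" by fastforce
        define d where "d = move_head m 0"
        have d: "\<bar>d\<bar> \<le> 1" by (cases m) (auto simp: d_def)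
        \<comment> \<open>The cone of row \<open>t\<close> is wider by one column, so it still
          contains the cell from which the symbol comes.\<close>
        then have zd: "\<bar>z + d\<bar> \<le> int T - int t" using z by auto
        have A: "ctrl (g t (nat (int T + z + d))) = Some ((p, rs), q', as)"
          using row[of "z + d" t] zd c t by (simp add: add.assoc)
        have B: "ctrl (g (Suc t) (nat (int T + z))) = Some tr"
          using row[of z "Suc t"] z t Some by simp
        have cen: "center (g t (nat (int T + z + d))) \<longleftrightarrow> z + d = 0"
          using tab(2)[of t "nat (int T + z + d)"] t zd by (auto simp: n_def)
        have "syms (g (Suc t) (nat (int T + z))) ! j =
            (if z + d = 0 then s else syms (g t (nat (int T + z + d))) ! j)"
          using vert[OF z, of m] A B j sm cen unfolding vert_def d_def[symmetric] by (auto simp: d_def)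
        also have "\<dots> = (if z + d = 0 then s else w (h + (z + d)))"
          using r(4)[OF j zd] hw by (simp add: add.assoc)
        also have "\<dots> = snd (map2 act_tape as ts ! j) (fst (map2 act_tape as ts ! j) + z)"
          using j as r(2) sm hw snd_act_tape[of s m h w z] by (simp add: d_def)
        finally show ?thesis by simp
      qed
      with Some reach' r(2) as q' have "reach (Suc t) q' (map2 act_tape as ts)"
        unfolding reach_def by simp
      then show ?thesis by blast
    qed
  qed
  have "ctrl (g T T) = None" using tab(4)[of T T] by (auto simp: n_def)
  then obtain t where t: "t \<le> T" "ctrl (g t T) = None" "\<forall>s<t. ctrl (g s T) \<noteq> None"
    using exists_least_iff[of "\<lambda>t. ctrl (g t T) = None"] by (metis linorder_not_less)
  then obtain q ts where "reach t q ts" using * by blast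
  with t show ?thesis unfolding reach_def accepts_within_def by auto
qed

text \<open>The symbols are taken from the actual two-way infinite tapes, so the cells at the border
  are correct as well. From the end \<open>n\<close> of the run on, rows are padded with blank tiles
  that carry no transition.\<close>

lemma tableau_if_accepts:
  assumes "turing_machine k \<Delta>" "accepts_within k \<Delta> T x"
  shows "\<exists>g. tableau k \<Delta> T x g"
proof -
  from assms(2) obtain n ts\<^sub>1 where n: "n \<le> T" "(init_config k x, (1, ts\<^sub>1)) \<in> step \<Delta> ^^ n"
    by (auto simp: accepts_within_def)
  then obtain f where f: "f 0 = init_config k x" "f n = (1, ts\<^sub>1)"
    "\<And>s. s < n \<Longrightarrow> (f s, f (Suc s)) \<in> step \<Delta>"
    unfolding relpow_fun_conv by blast
  have "\<exists>as. ((fst (f s), map read_tape (snd (f s))), fst (f (Suc s)), as) \<in> \<Delta> \<and>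
      snd (f (Suc s)) = map2 act_tape as (snd (f s))" if "s < n" for s
    using f(3)[OF that] unfolding step_def by auto
  then obtain as where as: "\<And>s. s < n \<Longrightarrow> ((fst (f s), map read_tape (snd (f s))), fst (f (Suc s)), as s) \<in> \<Delta>"
      "\<And>s. s < n \<Longrightarrow> snd (f (Suc s)) = map2 act_tape (as s) (snd (f s))"
    by metis
  have k: "k \<ge> 1" using assms(1) by (simp add: turing_machine_def)
  have len_as: "length (as s) = k" if "s < n" for s
    using assms(1) as(1)[OF that] unfolding turing_machine_def by fastforce
  have len: "length (snd (f s)) = k" if "s \<le> n" for s
    using that by (induction s) (use k len_as in \<open>auto simp: f(1) init_config_def as(2)\<close>)
  have sym: "\<forall>(h, w) \<in> set (snd (f s)). range w \<subseteq> symbols \<Delta>" if "s \<le> n" for s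
    using that
  proof (induction s)
    case 0
    show ?case by (auto simp: f(1) init_config_def word_on_tape_def symbols_def)
  next
    case (Suc s)
    then have s: "s < n" by simp
    have "range w' \<subseteq> symbols \<Delta>" if hw: "(h', w') \<in> set (snd (f (Suc s)))" for h' w'
    proof -
      from hw obtain a m h w where am: "(a, m) \<in> set (as s)" "(h, w) \<in> set (snd (f s))"
        and "(h', w') = act_tape (a, m) (h, w)"
        unfolding as(2)[OF s] by (force dest: set_zip_leftD set_zip_rightD)
      then have w': "w' = w(h := a)" by simp
      have "a \<in> symbols \<Delta>" using am(1) as(1)[OF s] unfolding symbols_def by force
      moreover have "range w \<subseteq> symbols \<Delta>"
        using bspec[OF Suc.IH[OF less_imp_le[OF s]] am(2)] by simp
      ultimately show ?thesis by (auto simp: w')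
    qed
    then show ?case by auto
  qed
  define tr where "tr s = ((fst (f s), map read_tape (snd (f s))), fst (f (Suc s)), as s)" for s
  define row where "row s i = map (\<lambda>(h, w). w (h + (int i - int T))) (snd (f s))" for s i
  define g where "g s i = (if s < n then Tile (Some (tr s)) (i = T) (row s i)
    else Tile None (i = T) (replicate k 0))" for s i
  have tile: "g t i \<in> tiles k \<Delta>" for t i
  proof (cases "t < n")
    case True
    have "set (row t i) \<subseteq> symbols \<Delta>" using sym[of t] True by (fastforce simp: row_def)
    moreover have "row t T = map read_tape (snd (f t))" by (auto simp: row_def)
    ultimately show ?thesis
      using True as(1) len by (auto simp: g_def tiles_def tr_def row_def)
  qed (auto simp: g_def tiles_def symbols_def)
  have init: "initial k (word_on_tape x (int i - int T)) (g 0 i)" for i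
  proof -
    \<comment> \<open>Row 0 must carry a transition. It does, since the initial state 0 is not the
      accepting state 1 and the run has at least one step.\<close>
    have "n > 0" using f(1,2) by (cases n) (auto simp: init_config_def)
    moreover have "row 0 i = word_on_tape x (int i - int T) # replicate (k - 1) 0"
      by (auto simp: row_def f(1) init_config_def word_on_tape_def)
    ultimately show ?thesis by (simp add: initial_def g_def tr_def f(1) init_config_def)
  qed
  have vert: "vert k d (g t i) (g (Suc t) i')" if d: "int i = int i' + d" for t i i' d
  proof (cases "Suc t < n")
    case True
    have "row (Suc t) i' ! j = (if i = T then fst (as t ! j) else row t i ! j)"
      if "j < k" "move_head (snd (as t ! j)) 0 = d" for j
    proof -
      obtain s m where sm: "as t ! j = (s, m)" by fastforce
      obtain h w where hw: "snd (f t) ! j = (h, w)" by fastforce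
      let ?z = "int i' - int T"
      have zd: "?z + move_head m 0 = int i - int T" using that(2) sm d by simp
      have "row (Suc t) i' ! j = snd (act_tape (s, m) (h, w)) (fst (act_tape (s, m) (h, w)) + ?z)"
        using that(1) len[of t] len_as[of t] as(2)[of t] True sm hw
        by (simp add: row_def split_beta)
      also have "\<dots> = (if i = T then s else w (h + (int i - int T)))"
        unfolding snd_act_tape zd by auto
      finally show ?thesis using that(1) len[of t] True sm hw by (simp add: row_def)
    qed
    then show ?thesis using True by (simp add: g_def vert_def tr_def)
  next
    case False
    \<comment> \<open>Row \<open>n\<close> is the first padded one; the transition in the row before
      it leads to state 1, as \<open>vert\<close> demands.\<close>
    then consider "Suc t = n" | "n \<le> t" by linarith
    then show ?thesis
      using f(2) by cases (auto simp: g_def vert_def tr_def)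
  qed
  have center: "center (g t i) \<longleftrightarrow> i = T" and horiz: "ctrl (g t i) = ctrl (g t j)"
    and last: "ctrl (g T i) = None" for t i j
    using n(1) by (auto simp: g_def)
  have "tableau k \<Delta> T x g"
    unfolding tableau_def using tile init n(1) center by (auto intro!: vert simp: horiz last)
  then show ?thesis by (rule exI[of _ g])
qed

lemma accepts_within_iff_tableau:
  "turing_machine k \<Delta> \<Longrightarrow> accepts_within k \<Delta> T x \<longleftrightarrow> (\<exists>g. tableau k \<Delta> T x g)"
  using accepts_if_tableau tableau_if_accepts by blast


section \<open>Emitting the examples\<close>

text \<open>The numbers are unary so that a \<open>For\<close> loop can write them, and the
  separators make the triple recoverable.\<close>

definition name :: "nat \<Rightarrow> nat \<Rightarrow> nat \<Rightarrow> symbol" where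
  "name t i a = replicate t True @ False # replicate i True @ False # replicate a True"

definition atom :: "symbol \<Rightarrow> nat \<times> nat \<times> nat \<Rightarrow> literal" where
  "atom c = (\<lambda>(t, i, a). Literal False (name t i a) [Fun c []])"

definition grid :: "nat \<Rightarrow> nat \<Rightarrow> nat \<Rightarrow> (nat \<times> nat \<times> nat) set" where
  "grid R W K = {..<R} \<times> {..<W} \<times> {..<K}"

text \<open>Taking \<open>p = q\<close> excludes a single tile from a cell and so expresses a unary
  constraint. If \<open>p\<close> or \<open>q\<close> lies outside the grid, nothing is removed on
  that side and every hypothesis over the grid subsumes the example; neighbours beyond the border
  thus require no special treatment.\<close>

definition nogood :: "nat \<Rightarrow> nat \<Rightarrow> nat \<Rightarrow> nat \<times> nat \<times> nat \<Rightarrow> nat \<times> nat \<times> nat \<Rightarrow> clause" where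
  "nogood R W K p q = atom [False] ` (grid R W K - {p}) \<union> atom [True] ` (grid R W K - {q})"

section \<open>Program outputs as sets of literals and of examples\<close>

definition items :: "('a \<Rightarrow> bool list) \<Rightarrow> 'a list \<Rightarrow> bool list" where
  "items e xs = concat (map (\<lambda>x. True # e x) xs)"

lemma encode_list_items: "encode_list e xs = items e xs @ [False]"
  by (simp add: encode_list_def items_def)

text \<open>Only the listed set matters, as order and repetitions are immaterial. Since
  \<open>items\<close> has no end mark, outputs can simply be concatenated. \<open>h\<close> takes a
  list element to its meaning: \<open>id\<close> for literals, \<open>set\<close> for
  examples.\<close>

definition emits :: "('a \<Rightarrow> bool list) \<Rightarrow> ('a \<Rightarrow> 'b) \<Rightarrow> prog \<Rightarrow> bool list \<Rightarrow> (nat \<Rightarrow> nat) \<Rightarrow> 'b set \<Rightarrow> bool" where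
  "emits e h p x \<sigma> X \<longleftrightarrow> (\<exists>ls. out p x \<sigma> = items e ls \<and> h ` set ls = X)"

lemma emits_cong: "emits e h p x \<sigma> X \<Longrightarrow> X = Y \<Longrightarrow> emits e h p x \<sigma> Y"
  by simp

lemma emits_empty: "emits e h (Emit []) x \<sigma> {}"
  unfolding emits_def by (intro exI[of _ "[]"]) (simp add: items_def)

lemma emits_Seq:
  "emits e h p x \<sigma> X \<Longrightarrow> emits e h q x \<sigma> Y \<Longrightarrow> emits e h (Seq p q) x \<sigma> (X \<union> Y)"
  unfolding emits_def items_def by (metis concat_append image_Un map_append out.simps(2) set_append)

lemma emits_IfEq:
  "(\<sigma> r = \<sigma> s \<Longrightarrow> emits e h p x \<sigma> X) \<Longrightarrow> (\<sigma> r \<noteq> \<sigma> s \<Longrightarrow> emits e h q x \<sigma> Y) \<Longrightarrow>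
   emits e h (IfEq y r s p q) x \<sigma> (if \<sigma> r = \<sigma> s then X else Y)"
  by (simp add: emits_def)

lemma emits_LetLen:
  "emits e h q x (\<sigma>(r := length (out p x \<sigma>))) X \<Longrightarrow> emits e h (LetLen r p q) x \<sigma> X"
  by (simp add: emits_def)

lemma items_concat:
  assumes "\<And>i. i < n \<Longrightarrow> \<exists>ls. f i = items e ls \<and> h ` set ls = X i"
  shows "\<exists>ls. concat (map f [0..<n]) = items e ls \<and> h ` set ls = (\<Union>i<n. X i)"
proof -
  obtain ls where "\<And>i. i < n \<Longrightarrow> f i = items e (ls i)" "\<And>i. i < n \<Longrightarrow> h ` set (ls i) = X i"
    using assms by metis
  then have "concat (map f [0..<m]) = items e (concat (map ls [0..<m])) \<and>
      h ` set (concat (map ls [0..<m])) = (\<Union>i<m. X i)" if "m \<le> n" for m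
    using that by (induction m) (auto simp: items_def lessThan_Suc image_Un)
  then show ?thesis by blast
qed

lemma emits_For:
  assumes "\<And>i. i < \<sigma> s \<Longrightarrow> emits e h p x (\<sigma>(r := i)) (X i)"
  shows "emits e h (For r s p) x \<sigma> (\<Union>i<\<sigma> s. X i)"
  using assms unfolding emits_def out.simps by (rule items_concat)

lemma emits_ForIn:
  assumes "\<And>i. i < length x \<Longrightarrow> x ! i \<Longrightarrow> emits e h p x (\<sigma>(r := i)) (X i)"
    and "\<And>i. i < length x \<Longrightarrow> \<not> x ! i \<Longrightarrow> emits e h q x (\<sigma>(r := i)) (Y i)"
  shows "emits e h (ForIn r p q) x \<sigma> (\<Union>i<length x. if x ! i then X i else Y i)"
  using assms unfolding emits_def out.simps by (intro items_concat) auto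

primrec seqs :: "prog list \<Rightarrow> prog" where
  "seqs [] = Emit []"
| "seqs (p # ps) = Seq p (seqs ps)"

lemma emits_seqs:
  "(\<And>a. a \<in> set as \<Longrightarrow> emits e h (f a) x \<sigma> (X a)) \<Longrightarrow> emits e h (seqs (map f as)) x \<sigma> (\<Union>a\<in>set as. X a)"
  by (induction as) (auto intro!: emits_empty emits_Seq)

lemma wf_seqs: "wf_prog m a A d (seqs ps) \<longleftrightarrow> (\<forall>p\<in>set ps. wf_prog m a A d p)"
  by (induction ps) auto

text \<open>
  Register 1 is never written and holds 0. Registers 2 to 5 hold the length of the input, the
  time bound, the number of rows and the number of columns of the tableau.
\<close>

definition atom_prog :: "symbol \<Rightarrow> nat \<Rightarrow> prog" where
  "atom_prog c a = seqs [Emit [True, False], For 17 12 (Emit [True, True]), Emit [True, False],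
     For 17 14 (Emit [True, True]),
     Emit ([True, False] @ concat (replicate a [True, True]) @ [False] @ encode_list encode_trm [Fun c []])]"

text \<open>One shape for all examples: \<open>as\<close> is the complete list in the two full
  examples, lacks one tile in nogoods, and is \<open>[]\<close> in negative examples. The loop
  registers 12 and 14 leave 13 and 15 to the counters of the loops.\<close>

definition column_prog :: "nat \<Rightarrow> symbol \<Rightarrow> nat \<Rightarrow> nat \<Rightarrow> nat list \<Rightarrow> prog" where
  "column_prog K c r s as =
     For 12 4 (For 14 5 (IfEq 16 12 r
       (IfEq 16 14 s (seqs (map (atom_prog c) as)) (seqs (map (atom_prog c) [0..<K])))
       (seqs (map (atom_prog c) [0..<K]))))"

definition example_prog :: "prog \<Rightarrow> prog" where
  "example_prog p = seqs [Emit [True], p, Emit [False]]"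

definition nogood_prog :: "nat \<Rightarrow> nat \<Rightarrow> nat \<Rightarrow> nat \<Rightarrow> nat \<Rightarrow> nat \<Rightarrow> nat \<Rightarrow> prog" where
  "nogood_prog K r s a r' s' b = example_prog (Seq
     (column_prog K [False] r s (filter (\<lambda>c. c \<noteq> a) [0..<K]))
     (column_prog K [True] r' s' (filter (\<lambda>c. c \<noteq> b) [0..<K])))"

lemma length_concat_replicate: "length (concat (map (\<lambda>i. [b]) [0..<n])) = n"
  by (induction n) auto

lemma concat_map_const: "concat (map (\<lambda>i. u) [0..<n]) = concat (replicate n u)"
  by (simp add: map_replicate_const)

lemma out_atom_prog:
  "out (atom_prog c a) x \<sigma> = True # encode_literal (atom c (\<sigma> 12, \<sigma> 14, a))"
  by (simp add: atom_prog_def concat_map_const encode_literal_def atom_def name_def encode_symbol_def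
      encode_list_def map_replicate)

lemma emits_atom_prog:
  "emits encode_literal id (atom_prog c a) x \<sigma> {atom c (\<sigma> 12, \<sigma> 14, a)}"
  unfolding emits_def out_atom_prog
  by (intro exI[of _ "[atom c (\<sigma> 12, \<sigma> 14, a)]"]) (simp add: items_def)

lemma emits_column_prog:
  assumes "r \<notin> {12, 14}" "s \<notin> {12, 14}"
  shows "emits encode_literal id (column_prog K c r s as) x \<sigma>
    (atom c ` {(t, i, a) \<in> {..<\<sigma> 4} \<times> {..<\<sigma> 5} \<times> UNIV.
       a \<in> (if t = \<sigma> r \<and> i = \<sigma> s then set as else {..<K})})"
proof -
  define A where "A t i = (if t = \<sigma> r \<and> i = \<sigma> s then set as else {..<K})" for t i
  let ?p = "IfEq 16 12 r
    (IfEq 16 14 s (seqs (map (atom_prog c) as)) (seqs (map (atom_prog c) [0..<K])))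
    (seqs (map (atom_prog c) [0..<K]))"
  have 1: "emits encode_literal id ?p x (\<sigma>(12 := t, 14 := i)) (\<Union>a\<in>A t i. {atom c (t, i, a)})" for t i
    by (rule emits_cong[OF emits_IfEq[OF emits_IfEq[OF emits_seqs emits_seqs] emits_seqs]];
        (rule emits_cong[OF emits_atom_prog])?) (use assms in \<open>auto simp: A_def\<close>)
  have 2: "emits encode_literal id (For 14 5 ?p) x (\<sigma>(12 := t))
      (\<Union>i<\<sigma> 5. \<Union>a\<in>A t i. {atom c (t, i, a)})" for t
    using emits_For[where \<sigma> = "\<sigma>(12 := t)" and s = 5, OF 1] by simp
  have "emits encode_literal id (For 12 4 (For 14 5 ?p)) x \<sigma>
      (\<Union>t<\<sigma> 4. \<Union>i<\<sigma> 5. \<Union>a\<in>A t i. {atom c (t, i, a)})"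
    using emits_For[where \<sigma> = \<sigma> and s = 4, OF 2] by simp
  then show ?thesis unfolding column_prog_def A_def[symmetric]
    by (rule emits_cong) auto
qed

lemma emits_example_prog:
  assumes "emits encode_literal id p x \<sigma> X"
  shows "emits (encode_list encode_literal) set (example_prog p) x \<sigma> {X}"
proof -
  obtain ls where "out p x \<sigma> = items encode_literal ls" "set ls = X"
    using assms by (auto simp: emits_def)
  then show ?thesis unfolding emits_def example_prog_def
    by (intro exI[of _ "[ls]"]) (simp add: items_def encode_list_def)
qed

lemma emits_nogood_prog:
  assumes "r \<notin> {12, 14}" "s \<notin> {12, 14}" "r' \<notin> {12, 14}" "s' \<notin> {12, 14}"
  shows "emits (encode_list encode_literal) set (nogood_prog K r s a r' s' b) x \<sigma>
    {nogood (\<sigma> 4) (\<sigma> 5) K (\<sigma> r, \<sigma> s, a) (\<sigma> r', \<sigma> s', b)}"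
  unfolding nogood_prog_def
proof (rule emits_example_prog, rule emits_cong[OF emits_Seq[OF emits_column_prog emits_column_prog]])
  have "{(t, i, a') \<in> {..<\<sigma> 4} \<times> {..<\<sigma> 5} \<times> UNIV.
       a' \<in> (if t = \<sigma> r \<and> i = \<sigma> s then set (filter (\<lambda>c. c \<noteq> a) [0..<K]) else {..<K})} =
      grid (\<sigma> 4) (\<sigma> 5) K - {(\<sigma> r, \<sigma> s, a)}" for r s a
    by (auto simp: grid_def split: if_splits)
  then show "atom [False] ` {(t, i, a') \<in> {..<\<sigma> 4} \<times> {..<\<sigma> 5} \<times> UNIV.
       a' \<in> (if t = \<sigma> r \<and> i = \<sigma> s then set (filter (\<lambda>c. c \<noteq> a) [0..<K]) else {..<K})} \<union>
    atom [True] ` {(t, i, a) \<in> {..<\<sigma> 4} \<times> {..<\<sigma> 5} \<times> UNIV.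
       a \<in> (if t = \<sigma> r' \<and> i = \<sigma> s' then set (filter (\<lambda>c. c \<noteq> b) [0..<K]) else {..<K})} =
    nogood (\<sigma> 4) (\<sigma> 5) K (\<sigma> r, \<sigma> s, a) (\<sigma> r', \<sigma> s', b)"
    by (simp only: nogood_def)
qed (use assms in auto)

text \<open>The tiles and \<open>P\<close> do not depend on the input. The forbidden tiles are
  therefore enumerated when the program is built, and only the cell is looked up in
  registers.\<close>

definition unary_prog :: "tile list \<Rightarrow> (tile \<Rightarrow> bool) \<Rightarrow> nat \<Rightarrow> nat \<Rightarrow> prog" where
  "unary_prog ts P r s =
     seqs (map (\<lambda>a. nogood_prog (length ts) r s a r s a) (filter (\<lambda>a. \<not> P (ts ! a)) [0..<length ts]))"

definition binary_prog :: "tile list \<Rightarrow> (tile \<Rightarrow> tile \<Rightarrow> bool) \<Rightarrow> nat \<Rightarrow> nat \<Rightarrow> nat \<Rightarrow> nat \<Rightarrow> prog" where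
  "binary_prog ts P r s r' s' =
     seqs (map (\<lambda>(a, b). nogood_prog (length ts) r s a r' s' b)
       (filter (\<lambda>(a, b). \<not> P (ts ! a) (ts ! b)) (List.product [0..<length ts] [0..<length ts])))"

definition unary :: "nat \<Rightarrow> nat \<Rightarrow> tile list \<Rightarrow> (tile \<Rightarrow> bool) \<Rightarrow> nat \<Rightarrow> nat \<Rightarrow> clause set" where
  "unary R W ts P t i =
     {nogood R W (length ts) (t, i, a) (t, i, a) | a. a < length ts \<and> \<not> P (ts ! a)}"

definition binary :: "nat \<Rightarrow> nat \<Rightarrow> tile list \<Rightarrow> (tile \<Rightarrow> tile \<Rightarrow> bool) \<Rightarrow>
    nat \<Rightarrow> nat \<Rightarrow> nat \<Rightarrow> nat \<Rightarrow> clause set" where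
  "binary R W ts P t i t' i' = {nogood R W (length ts) (t, i, a) (t', i', b) | a b.
     a < length ts \<and> b < length ts \<and> \<not> P (ts ! a) (ts ! b)}"

lemma emits_unary_prog:
  assumes "r \<notin> {12, 14}" "s \<notin> {12, 14}"
  shows "emits (encode_list encode_literal) set (unary_prog ts P r s) x \<sigma>
    (unary (\<sigma> 4) (\<sigma> 5) ts P (\<sigma> r) (\<sigma> s))"
  unfolding unary_prog_def
  by (rule emits_cong[OF emits_seqs], rule emits_nogood_prog) (use assms in \<open>auto simp: unary_def\<close>)

lemma emits_binary_prog:
  assumes "r \<notin> {12, 14}" "s \<notin> {12, 14}" "r' \<notin> {12, 14}" "s' \<notin> {12, 14}"
  shows "emits (encode_list encode_literal) set (binary_prog ts P r s r' s') x \<sigma>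
    (binary (\<sigma> 4) (\<sigma> 5) ts P (\<sigma> r) (\<sigma> s) (\<sigma> r') (\<sigma> s'))"
proof -
  let ?as = "filter (\<lambda>(a, b). \<not> P (ts ! a) (ts ! b)) (List.product [0..<length ts] [0..<length ts])"
  have "emits (encode_list encode_literal) set (binary_prog ts P r s r' s') x \<sigma>
    (\<Union>c\<in>set ?as. {nogood (\<sigma> 4) (\<sigma> 5) (length ts) (\<sigma> r, \<sigma> s, fst c) (\<sigma> r', \<sigma> s', snd c)})"
    unfolding binary_prog_def
    using emits_nogood_prog[OF assms] by (intro emits_seqs) (auto simp: split_beta)
  then show ?thesis by (rule emits_cong) (auto simp: binary_def, blast+)
qed

section \<open>Arithmetic through output lengths\<close>

definition sum_prog :: "nat list \<Rightarrow> prog" where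
  "sum_prog rs = seqs (map (\<lambda>r. For 17 r (Emit [True])) rs)"

lemma length_out_sum_prog: "length (out (sum_prog rs) x \<sigma>) = (\<Sum>r\<leftarrow>rs. \<sigma> r)"
  by (induction rs) (simp_all add: sum_prog_def length_concat_replicate)

definition suc_prog :: "nat \<Rightarrow> prog" where
  "suc_prog r = Seq (For 17 r (Emit [True])) (Emit [True])"

lemma length_out_suc_prog: "length (out (suc_prog r) x \<sigma>) = Suc (\<sigma> r)"
  by (simp add: suc_prog_def length_concat_replicate)

text \<open>Horner's scheme: the remaining polynomial is repeated once per input symbol, the number
  of which is in register 2.\<close>

primrec poly_prog :: "nat list \<Rightarrow> nat \<Rightarrow> prog" where
  "poly_prog [] r = Emit []"
| "poly_prog (c # cs) r = Seq (Emit (replicate c True)) (For r 2 (poly_prog cs (r + 2)))"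

lemma length_out_poly_prog:
  "2 < r \<Longrightarrow> length (out (poly_prog cs r) x \<sigma>) = poly (Poly cs) (\<sigma> 2)"
proof (induction cs arbitrary: r \<sigma>)
  case (Cons c cs)
  have "length (out (poly_prog cs (r + 2)) x (\<sigma>(r := i))) = poly (Poly cs) (\<sigma> 2)" for i
    using Cons by simp
  then show ?case by (simp add: length_concat o_def sum_list_triv)
qed simp

lemma wf_poly_prog: "2 \<in> A \<Longrightarrow> d \<le> r \<Longrightarrow> r + 2 * length cs \<le> m \<Longrightarrow> wf_prog m a A d (poly_prog cs r)"
  by (induction cs arbitrary: A d r) auto

text \<open>Registers 6 and 8 hold a cell in the constraint loop, 10 and 11 the successors of its
  row and column. Register 3 serves both as the central column and as the last row, register 1 as
  row 0. The last three entries treat row 0 as blanks, input and blanks.\<close>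

definition positives_prog :: "nat \<Rightarrow> tile list \<Rightarrow> prog" where
  "positives_prog k ts = seqs
    [example_prog (column_prog (length ts) [False] 1 1 [0..<length ts]),
     example_prog (column_prog (length ts) [True] 1 1 [0..<length ts]),
     For 6 4 (For 8 5 (LetLen 10 (suc_prog 6) (LetLen 11 (suc_prog 8) (seqs
       [IfEq 16 8 3 (unary_prog ts center 6 8) (unary_prog ts (\<lambda>A. \<not> center A) 6 8),
        binary_prog ts (\<lambda>A B. ctrl A = ctrl B) 6 8 6 11,
        binary_prog ts (vert k 0) 6 8 10 8,
        binary_prog ts (vert k 1) 6 11 10 8,
        binary_prog ts (vert k (-1)) 6 8 10 11])))),
     For 8 5 (unary_prog ts (\<lambda>A. ctrl A = None) 3 8),
     For 8 3 (unary_prog ts (initial k 0) 1 8),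
     ForIn 6 (LetLen 8 (sum_prog [3, 6]) (unary_prog ts (initial k 2) 1 8))
             (LetLen 8 (sum_prog [3, 6]) (unary_prog ts (initial k 1) 1 8)),
     For 6 4 (LetLen 8 (sum_prog [3, 2, 6]) (unary_prog ts (initial k 0) 1 8))]"

definition negatives_prog :: "tile list \<Rightarrow> prog" where
  "negatives_prog ts = For 6 4 (For 8 5 (example_prog (column_prog (length ts) [False] 6 8 [])))"

definition reduction_prog :: "nat \<Rightarrow> tile list \<Rightarrow> nat poly \<Rightarrow> prog" where
  "reduction_prog k ts p =
     LetLen 2 (ForIn 6 (Emit [True]) (Emit [True]))
    (LetLen 3 (poly_prog (coeffs p) 6)
    (LetLen 4 (suc_prog 3)
    (LetLen 5 (sum_prog [3, 2, 4])
       (seqs [positives_prog k ts, Emit [False], negatives_prog ts, Emit [False]]))))"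

definition positives :: "nat \<Rightarrow> tile list \<Rightarrow> nat \<Rightarrow> bool list \<Rightarrow> clause set" where
  "positives k ts T x = (let R = Suc T; W = T + length x + R in
     {atom [False] ` grid R W (length ts), atom [True] ` grid R W (length ts)} \<union>
     (\<Union>t<R. \<Union>i<W. unary R W ts (\<lambda>A. center A \<longleftrightarrow> i = T) t i \<union>
        binary R W ts (\<lambda>A B. ctrl A = ctrl B) t i t (Suc i) \<union>
        binary R W ts (vert k 0) t i (Suc t) i \<union>
        binary R W ts (vert k 1) t (Suc i) (Suc t) i \<union>
        binary R W ts (vert k (-1)) t i (Suc t) (Suc i)) \<union>
     (\<Union>i<W. unary R W ts (\<lambda>A. ctrl A = None) T i \<union>
        unary R W ts (initial k (word_on_tape x (int i - int T))) 0 i))"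

definition negatives :: "tile list \<Rightarrow> nat \<Rightarrow> bool list \<Rightarrow> clause set" where
  "negatives ts T x = (let R = Suc T; W = T + length x + R in
     (\<Union>t<R. \<Union>i<W. {atom [False] ` (grid R W (length ts) - {t} \<times> {i} \<times> UNIV)}))"

lemma wf_reduction_prog: "\<exists>m\<ge>1. wf_prog m True {1} 2 (reduction_prog k ts p)"
proof -
  \<comment> \<open>Registers up to 18 have fixed roles; \<open>poly_prog\<close> starts at 6 and
    takes two per coefficient.\<close>
  define m where "m = 20 + 2 * length (coeffs p)"
  have m: "n < m" "n \<le> m" if "n \<le> 18" for n
    using that by (simp_all add: m_def)
  have atom: "wf_prog m a A 16 (atom_prog c b)" if "{12, 14} \<subseteq> A" for a A c b
    using that by (simp add: atom_prog_def m)
  have column: "wf_prog m a A d (column_prog K c r s as)"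
    if "{4, 5, r, s} \<subseteq> A" "d \<le> 12" "r \<noteq> 12" "s \<noteq> 14" for a A d K c r s as
    using that by (auto simp: column_prog_def wf_seqs m intro!: atom)
  have example: "wf_prog m a A d (example_prog q) \<longleftrightarrow> wf_prog m a A d q" for a A d q
    by (simp add: example_prog_def)
  have nogood: "wf_prog m a A d (nogood_prog K r s b r' s' b')"
    if "{4, 5, r, s, r', s'} \<subseteq> A" "d \<le> 12" "r \<noteq> 12" "s \<noteq> 14" "r' \<noteq> 12" "s' \<noteq> 14"
    for a A d K r s r' s' b b'
    using that by (simp add: nogood_prog_def example column)
  have unary: "wf_prog m a A d (unary_prog ts P r s)"
    if "{4, 5, r, s} \<subseteq> A" "d \<le> 12" "r \<noteq> 12" "s \<noteq> 14" for a A d P r s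
    using that by (auto simp: unary_prog_def wf_seqs intro!: nogood)
  have binary: "wf_prog m a A d (binary_prog ts P r s r' s')"
    if "{4, 5, r, s, r', s'} \<subseteq> A" "d \<le> 12" "r \<noteq> 12" "s \<noteq> 14" "r' \<noteq> 12" "s' \<noteq> 14"
    for a A d P r s r' s'
    using that by (auto simp: binary_prog_def wf_seqs intro!: nogood)
  have sum: "wf_prog m a A d (sum_prog rs)" if "set rs \<subseteq> A" "d \<le> 17" for a A d rs
    using that by (auto simp: sum_prog_def wf_seqs m)
  have suc: "wf_prog m a A d (suc_prog r)" if "r \<in> A" "d \<le> 17" for a A d r
    using that by (simp add: suc_prog_def m)
  have "wf_prog m True {5, 4, 3, 2, 1} 6 (positives_prog k ts)"
    "wf_prog m True {5, 4, 3, 2, 1} 6 (negatives_prog ts)"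
    unfolding positives_prog_def negatives_prog_def by (simp_all add: example column unary binary sum suc m)
  then have "wf_prog m True {1} 2 (reduction_prog k ts p)"
    unfolding reduction_prog_def
    by (simp add: sum suc m) (simp add: m_def wf_poly_prog)
  then show ?thesis by (intro exI[of _ m]) (simp add: m_def)
qed

text \<open>Matches the three programs for row 0: a loop over \<open>T\<close> columns, a scan of
  the input, and a loop over the remaining \<open>R\<close> columns.\<close>

lemma word_on_tape_split:
  "(\<Union>i<T + length x + R. F (word_on_tape x (int i - int T)) i) =
     (\<Union>i<T. F 0 i) \<union> (\<Union>i<length x. if x ! i then F 2 (T + i) else F 1 (T + i)) \<union>
     (\<Union>i<R. F 0 (T + length x + i))" (is "?L = ?A \<union> ?B \<union> ?C")
proof -
  have "{..<T + length x + R} = {..<T} \<union> (+) T ` {..<length x} \<union> (+) (T + length x) ` {..<R}"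
  proof (intro equalityI subsetI)
    fix i assume "i \<in> {..<T + length x + R}"
    then consider "i < T" | "T \<le> i" "i - T < length x" | "T + length x \<le> i" "i - (T + length x) < R"
      by force
    then show "i \<in> {..<T} \<union> (+) T ` {..<length x} \<union> (+) (T + length x) ` {..<R}"
      by cases (auto intro: image_eqI[of _ _ "i - T"] image_eqI[of _ _ "i - (T + length x)"])
  qed auto
  moreover have "(\<Union>i<T. F (word_on_tape x (int i - int T)) i) = ?A"
    by (simp add: word_on_tape_def)
  moreover have "(\<Union>i<length x. F (word_on_tape x (int (T + i) - int T)) (T + i)) = ?B"
    by (auto simp: word_on_tape_def split: if_splits)
  moreover have "(\<Union>i<R. F (word_on_tape x (int (T + length x + i) - int T)) (T + length x + i)) = ?C"
    by (simp add: word_on_tape_def)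
  ultimately show ?thesis by (simp only: UN_Un image_image UN_simps)
qed

lemma emits_full:
  assumes "\<sigma> 1 = 0"
  shows "emits (encode_list encode_literal) set
    (example_prog (column_prog K c 1 1 [0..<K])) x \<sigma> {atom c ` grid (\<sigma> 4) (\<sigma> 5) K}"
proof (rule emits_example_prog, rule emits_cong[OF emits_column_prog])
  show "atom c ` {(t, i, a) \<in> {..<\<sigma> 4} \<times> {..<\<sigma> 5} \<times> UNIV.
      a \<in> (if t = \<sigma> 1 \<and> i = \<sigma> 1 then set [0..<K] else {..<K})} = atom c ` grid (\<sigma> 4) (\<sigma> 5) K"
    by (rule arg_cong[where f = "image (atom c)"]) (auto simp: grid_def split: if_splits)
qed auto

lemma emits_positives:
  fixes x :: "bool list"
  assumes \<sigma>: "\<sigma> 1 = 0" "\<sigma> 2 = length x" "\<sigma> 3 = T" "\<sigma> 4 = Suc T" "\<sigma> 5 = T + length x + Suc T"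
  shows "emits (encode_list encode_literal) set (positives_prog k ts) x \<sigma> (positives k ts T x)"
proof -
  let ?E = "emits (encode_list encode_literal) set"
  define R where "R = Suc T"
  define W where "W = T + length x + R"
  note \<sigma>' = \<sigma>(1-3) \<sigma>(4)[folded R_def] \<sigma>(5)[folded R_def, folded W_def]
  define F where "F s i = unary R W ts (initial k s) 0 i" for s i
  \<comment> \<open>Nested to the right and closed by \<open>{}\<close> in order to have the shape
    of \<open>seqs\<close>.\<close>
  define G where "G t i = unary R W ts (\<lambda>A. center A \<longleftrightarrow> i = T) t i \<union>
        (binary R W ts (\<lambda>A B. ctrl A = ctrl B) t i t (Suc i) \<union>
        (binary R W ts (vert k 0) t i (Suc t) i \<union>
        (binary R W ts (vert k 1) t (Suc i) (Suc t) i \<union>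
        (binary R W ts (vert k (-1)) t i (Suc t) (Suc i) \<union> {}))))" for t i

  let ?c = "IfEq 16 8 3 (unary_prog ts center 6 8) (unary_prog ts (\<lambda>A. \<not> center A) 6 8)"
  let ?p = "seqs [?c,
        binary_prog ts (\<lambda>A B. ctrl A = ctrl B) 6 8 6 11,
        binary_prog ts (vert k 0) 6 8 10 8,
        binary_prog ts (vert k 1) 6 11 10 8,
        binary_prog ts (vert k (-1)) 6 8 10 11]"
  have c: "?E ?c x \<tau> (unary (\<tau> 4) (\<tau> 5) ts (\<lambda>A. center A \<longleftrightarrow> \<tau> 8 = \<tau> 3) (\<tau> 6) (\<tau> 8))" for \<tau>
    by (rule emits_cong[OF emits_IfEq[OF emits_unary_prog emits_unary_prog]]) auto
  have "?E ?p x (\<sigma>(6 := t, 8 := i, 10 := Suc t, 11 := Suc i)) (G t i)" for t i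
    unfolding seqs.simps G_def
    by (intro emits_Seq emits_empty; rule emits_cong[OF c] emits_cong[OF emits_binary_prog]) (auto simp: \<sigma>')
  then have "?E (LetLen 10 (suc_prog 6) (LetLen 11 (suc_prog 8) ?p)) x (\<sigma>(6 := t, 8 := i)) (G t i)" for t i
    by (intro emits_LetLen) (simp add: length_out_suc_prog)
  from emits_For[where \<sigma> = "\<sigma>(6 := t)" and s = 5 for t, OF this]
  have "?E (For 8 5 (LetLen 10 (suc_prog 6) (LetLen 11 (suc_prog 8) ?p))) x (\<sigma>(6 := t)) (\<Union>i<W. G t i)" for t
    by (simp add: \<sigma>')
  from emits_For[where \<sigma> = \<sigma> and s = 4, OF this]
  have 1: "?E (For 6 4 (For 8 5 (LetLen 10 (suc_prog 6) (LetLen 11 (suc_prog 8) ?p)))) x \<sigma> (\<Union>t<R. \<Union>i<W. G t i)"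
    by (simp add: \<sigma>')

  have "?E (unary_prog ts (\<lambda>A. ctrl A = None) 3 8) x (\<sigma>(8 := i))
      (unary R W ts (\<lambda>A. ctrl A = None) T i)" for i
    by (rule emits_cong[OF emits_unary_prog]) (auto simp: \<sigma>')
  from emits_For[where \<sigma> = \<sigma> and s = 5, OF this]
  have 2: "?E (For 8 5 (unary_prog ts (\<lambda>A. ctrl A = None) 3 8)) x \<sigma>
      (\<Union>i<W. unary R W ts (\<lambda>A. ctrl A = None) T i)"
    by (simp add: \<sigma>')

  have init: "?E (unary_prog ts (initial k s) 1 8) x (\<tau>(8 := i)) (F s i)"
    if "\<tau> 1 = 0" "\<tau> 4 = R" "\<tau> 5 = W" for s i \<tau>
    by (rule emits_cong[OF emits_unary_prog]) (use that in \<open>auto simp: F_def\<close>)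
  have 3: "?E (For 8 3 (unary_prog ts (initial k 0) 1 8)) x \<sigma> (\<Union>i<T. F 0 i)"
    using emits_For[where \<sigma> = \<sigma> and s = 3, OF init[OF \<sigma>'(1,4,5), of 0]] by (simp add: \<sigma>')
  have "?E (LetLen 8 (sum_prog [3, 6]) (unary_prog ts (initial k s) 1 8)) x (\<sigma>(6 := i)) (F s (T + i))" for s i
    using init[of "\<sigma>(6 := i)" s "T + i"] by (intro emits_LetLen) (simp add: length_out_sum_prog \<sigma>' del: One_nat_def)
  then have 4: "?E (ForIn 6 (LetLen 8 (sum_prog [3, 6]) (unary_prog ts (initial k 2) 1 8))
             (LetLen 8 (sum_prog [3, 6]) (unary_prog ts (initial k 1) 1 8))) x \<sigma>
     (\<Union>i<length x. if x ! i then F 2 (T + i) else F 1 (T + i))"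
    by (intro emits_ForIn)
  have "?E (LetLen 8 (sum_prog [3, 2, 6]) (unary_prog ts (initial k 0) 1 8)) x (\<sigma>(6 := i)) (F 0 (T + length x + i))" for i
    using init[of "\<sigma>(6 := i)" 0 "T + length x + i"]
    by (intro emits_LetLen) (simp add: length_out_sum_prog \<sigma>' add.assoc del: One_nat_def)
  from emits_For[where \<sigma> = \<sigma> and s = 4, OF this]
  have 5: "?E (For 6 4 (LetLen 8 (sum_prog [3, 2, 6]) (unary_prog ts (initial k 0) 1 8))) x \<sigma>
      (\<Union>i<R. F 0 (T + length x + i))"
    by (simp add: \<sigma>')

  have "?E (positives_prog k ts) x \<sigma>
    ({atom [False] ` grid (\<sigma> 4) (\<sigma> 5) (length ts)} \<union> ({atom [True] ` grid (\<sigma> 4) (\<sigma> 5) (length ts)} \<union>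
     ((\<Union>t<R. \<Union>i<W. G t i) \<union> ((\<Union>i<W. unary R W ts (\<lambda>A. ctrl A = None) T i) \<union> ((\<Union>i<T. F 0 i) \<union>
     ((\<Union>i<length x. if x ! i then F 2 (T + i) else F 1 (T + i)) \<union> ((\<Union>i<R. F 0 (T + length x + i)) \<union> {})))))))"
    unfolding positives_prog_def seqs.simps(2)[of _ "_ # _"] seqs.simps
    by (intro emits_Seq emits_empty emits_full \<sigma>(1) 1[unfolded seqs.simps] 2 3 4 5)
  then show ?thesis
  proof (rule emits_cong)
    have "positives k ts T x = {atom [False] ` grid R W (length ts), atom [True] ` grid R W (length ts)} \<union>
      (\<Union>t<R. \<Union>i<W. G t i) \<union> (\<Union>i<W. unary R W ts (\<lambda>A. ctrl A = None) T i) \<union>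
      (\<Union>i<W. F (word_on_tape x (int i - int T)) i)"
      unfolding positives_def Let_def R_def[symmetric] W_def[symmetric] G_def F_def by blast
    also have "(\<Union>i<W. F (word_on_tape x (int i - int T)) i) = (\<Union>i<T. F 0 i) \<union>
      (\<Union>i<length x. if x ! i then F 2 (T + i) else F 1 (T + i)) \<union> (\<Union>i<R. F 0 (T + length x + i))"
      unfolding W_def by (rule word_on_tape_split)
    finally show "{atom [False] ` grid (\<sigma> 4) (\<sigma> 5) (length ts)} \<union> ({atom [True] ` grid (\<sigma> 4) (\<sigma> 5) (length ts)} \<union>
     ((\<Union>t<R. \<Union>i<W. G t i) \<union> ((\<Union>i<W. unary R W ts (\<lambda>A. ctrl A = None) T i) \<union> ((\<Union>i<T. F 0 i) \<union>
     ((\<Union>i<length x. if x ! i then F 2 (T + i) else F 1 (T + i)) \<union> ((\<Union>i<R. F 0 (T + length x + i)) \<union> {}))))))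
     = positives k ts T x"
      by (simp add: \<sigma>' insert_commute Un_ac)
  qed
qed

lemma emits_negatives:
  fixes x :: "bool list"
  assumes \<sigma>: "\<sigma> 4 = Suc T" "\<sigma> 5 = T + length x + Suc T"
  shows "emits (encode_list encode_literal) set (negatives_prog ts) x \<sigma> (negatives ts T x)"
proof -
  let ?E = "emits (encode_list encode_literal) set"
  let ?R = "Suc T" and ?W = "T + length x + Suc T"
  let ?p = "example_prog (column_prog (length ts) [False] 6 8 [])"
  let ?X = "\<lambda>t i. {atom [False] ` (grid ?R ?W (length ts) - {t} \<times> {i} \<times> UNIV)}"
  have "?E ?p x (\<sigma>(6 := t, 8 := i)) (?X t i)" for t i
    by (rule emits_example_prog, rule emits_cong[OF emits_column_prog])
      (use \<sigma> in \<open>auto simp: grid_def intro!: arg_cong[where f = "image (atom [False])"] split: if_splits\<close>)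
  from emits_For[where \<sigma> = "\<sigma>(6 := t)" and s = 5 for t, OF this]
  have "?E (For 8 5 ?p) x (\<sigma>(6 := t)) (\<Union>i<?W. ?X t i)" for t
    by (simp add: \<sigma> del: UN_insert)
  from emits_For[where \<sigma> = \<sigma> and s = 4, OF this]
  show ?thesis unfolding negatives_prog_def negatives_def Let_def by (simp only: \<sigma>)
qed

lemma out_reduction_prog:
  obtains Ps Ns where "out (reduction_prog k ts p) x (\<lambda>_. 0) = encode_instance (Ps, Ns)"
    "set ` set Ps = positives k ts (poly p (length x)) x"
    "set ` set Ns = negatives ts (poly p (length x)) x"
proof -
  define T where "T = poly p (length x)"
  define \<sigma> :: "nat \<Rightarrow> nat" where
    "\<sigma> = (\<lambda>_. 0)(2 := length x, 3 := T, 4 := Suc T, 5 := T + length x + Suc T)"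
  have \<sigma>: "\<sigma> 1 = 0" "\<sigma> 2 = length x" "\<sigma> 3 = T" "\<sigma> 4 = Suc T" "\<sigma> 5 = T + length x + Suc T"
    by (simp_all add: \<sigma>_def)
  obtain Ps where Ps: "out (positives_prog k ts) x \<sigma> = items (encode_list encode_literal) Ps"
    "set ` set Ps = positives k ts T x"
    using emits_positives[OF \<sigma>] unfolding emits_def by blast
  obtain Ns where Ns: "out (negatives_prog ts) x \<sigma> = items (encode_list encode_literal) Ns"
    "set ` set Ns = negatives ts T x"
    using emits_negatives[OF \<sigma>(4,5)] unfolding emits_def by blast
  have "length (out (ForIn 6 (Emit [True]) (Emit [True])) x \<tau>) = length x" for \<tau>
    by (simp add: length_concat_replicate)
  then have "out (reduction_prog k ts p) x (\<lambda>_. 0) =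
      out (seqs [positives_prog k ts, Emit [False], negatives_prog ts, Emit [False]]) x \<sigma>"
    by (simp add: reduction_prog_def length_out_poly_prog length_out_suc_prog length_out_sum_prog T_def \<sigma>_def
        add.assoc del: out.simps(4))
  also have "\<dots> = encode_instance (Ps, Ns)"
    by (simp add: Ps Ns encode_instance_def encode_examples_def encode_list_items)
  finally show thesis using that Ps(2) Ns(2) unfolding T_def by blast
qed


section \<open>From solutions to tableaux\<close>

lemma replicate_eq_iff:
  "replicate n True @ False # u = replicate m True @ False # v \<longleftrightarrow> n = m \<and> u = v"
proof (induction n arbitrary: m)
  case 0
  show ?case by (cases m) auto
next
  case (Suc n)
  then show ?case by (cases m) auto
qed

lemma name_eq_iff: "name t i a = name t' i' a' \<longleftrightarrow> t = t' \<and> i = i' \<and> a = a'"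
  by (simp add: name_def replicate_eq_iff)

lemma atom_eq_iff [simp]: "atom c p = atom d q \<longleftrightarrow> c = d \<and> p = q"
  by (auto simp: atom_def name_eq_iff split: prod.splits)

definition hyp :: "symbol \<Rightarrow> (nat \<times> nat \<times> nat) set \<Rightarrow> clause" where
  "hyp v S = (\<lambda>(t, i, a). Literal False (name t i a) [Var v]) ` S"

lemma subst_hyp:
  assumes "\<theta> v = Fun c []"
  shows "subst_literal \<theta> ` hyp v S = atom c ` S"
  using assms unfolding hyp_def image_image
  by (intro image_cong) (auto simp: subst_literal_def atom_def)

text \<open>As \<open>S\<close> is nonempty, some literal forces the variable to be mapped to
  \<open>c\<close> or to \<open>d\<close>. The whole hypothesis then becomes atoms over this
  constant, and injectivity of \<open>atom\<close> reduces inclusion of clauses to inclusion of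
  index sets.\<close>

lemma subsumes_hyp_iff:
  assumes "S \<noteq> {}" "c \<noteq> d"
  shows "subsumes (hyp v S) (atom c ` A \<union> atom d ` B) \<longleftrightarrow> S \<subseteq> A \<or> S \<subseteq> B"
proof
  assume "subsumes (hyp v S) (atom c ` A \<union> atom d ` B)"
  then obtain \<theta> where \<theta>: "subst_literal \<theta> ` hyp v S \<subseteq> atom c ` A \<union> atom d ` B"
    by (auto simp: subsumes_def)
  from assms(1) obtain t i a where "(t, i, a) \<in> S" by auto
  then have "Literal False (name t i a) [Var v] \<in> hyp v S"
    unfolding hyp_def by (intro image_eqI[of _ _ "(t, i, a)"]) auto
  from imageI[OF this, of "subst_literal \<theta>"]
  have "Literal False (name t i a) [\<theta> v] \<in> subst_literal \<theta> ` hyp v S"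
    by (simp add: subst_literal_def)
  with \<theta> have "\<theta> v = Fun c [] \<or> \<theta> v = Fun d []" by (auto simp: atom_def)
  moreover have "S \<subseteq> A" if "atom c ` S \<subseteq> atom c ` A \<union> atom d ` B" "c \<noteq> d" for c d A B
  proof
    fix p assume "p \<in> S"
    with that(1) have "atom c p \<in> atom c ` A \<union> atom d ` B" by blast
    with that(2) show "p \<in> A" by (auto simp: image_iff)
  qed
  from this[of c A d B] this[of d B c A] have
    "\<theta> v = Fun c [] \<Longrightarrow> S \<subseteq> A" "\<theta> v = Fun d [] \<Longrightarrow> S \<subseteq> B"
    using \<theta> assms(2) subst_hyp[of \<theta> v c S] subst_hyp[of \<theta> v d S] by (simp_all add: Un_commute)
  ultimately show "S \<subseteq> A \<or> S \<subseteq> B" by blast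
next
  assume "S \<subseteq> A \<or> S \<subseteq> B"
  then have "atom c ` S \<subseteq> atom c ` A \<union> atom d ` B \<or> atom d ` S \<subseteq> atom c ` A \<union> atom d ` B"
    by (auto simp: image_iff)
  then have "subst_literal (\<lambda>_. Fun c []) ` hyp v S \<subseteq> atom c ` A \<union> atom d ` B \<or>
      subst_literal (\<lambda>_. Fun d []) ` hyp v S \<subseteq> atom c ` A \<union> atom d ` B"
    by (simp only: subst_hyp)
  then show "subsumes (hyp v S) (atom c ` A \<union> atom d ` B)"
    unfolding subsumes_def by (elim disjE) (rule exI, assumption)+
qed

lemma subsumes_hyp_single_iff:
  assumes "S \<noteq> {}"
  shows "subsumes (hyp v S) (atom c ` A) \<longleftrightarrow> S \<subseteq> A"
  \<comment> \<open>\<open>True # c\<close> is a second constant different from \<open>c\<close>;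
    its index set is empty and cannot contain the nonempty \<open>S\<close>.\<close>
  using subsumes_hyp_iff[OF assms, of c "True # c" v A "{}"] assms by simp

text \<open>One substitution takes each literal to an atom over \<open>[False]\<close>, another
  takes it to an atom over \<open>[True]\<close>; its argument can be no constant and no compound
  term, hence is a variable. The guard is unary too, so its only variable is the variable of all
  literals. \<open>S\<close> is nonempty because it accounts for the guard.\<close>

lemma guarded_hyp:
  assumes "guarded H"
    and "subsumes H (atom [False] ` A)" "subsumes H (atom [True] ` A)"
  obtains v S where "H = hyp v S" "S \<subseteq> A" "S \<noteq> {}"
proof -
  obtain \<theta> \<eta> where \<theta>: "subst_literal \<theta> ` H \<subseteq> atom [False] ` A"
    and \<eta>: "subst_literal \<eta> ` H \<subseteq> atom [True] ` A"
    using assms by (auto simp: subsumes_def)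
  have lit: "\<exists>v t i a. (t, i, a) \<in> A \<and> L = Literal False (name t i a) [Var v]" if "L \<in> H" for L
  proof -
    from \<theta> that have "subst_literal \<theta> L \<in> atom [False] ` A" by blast
    then obtain p where "subst_literal \<theta> L = atom [False] p" "p \<in> A" by (rule imageE)
    then obtain t i a where p: "(t, i, a) \<in> A" "subst_literal \<theta> L = atom [False] (t, i, a)"
      by (cases p) simp
    from \<eta> that have "subst_literal \<eta> L \<in> atom [True] ` A" by blast
    then obtain q where q: "subst_literal \<eta> L = atom [True] q" by (rule imageE)
    from p(2) obtain s where s: "L = Literal False (name t i a) [s]" "subst_trm \<theta> s = Fun [False] []"
      by (cases L) (auto simp: subst_literal_def atom_def)
    from q s(1) have "subst_trm \<eta> s = Fun [True] []"
      by (cases q) (auto simp: subst_literal_def atom_def)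
    with s(2) obtain v where "s = Var v" by (cases s) auto
    with p(1) s(1) show ?thesis by blast
  qed
  from assms(1) obtain G where G: "G \<in> H" "(\<Union>R\<in>H. vars_literal R) \<subseteq> vars_literal G"
    by (auto simp: guarded_def)
  from lit[OF G(1)] obtain v where v: "vars_literal G = {v}" by (auto simp: vars_literal_def)
  have lit': "\<exists>t i a. (t, i, a) \<in> A \<and> L = Literal False (name t i a) [Var v]" if L: "L \<in> H" for L
  proof -
    from lit[OF L] obtain w t i a where w: "(t, i, a) \<in> A" "L = Literal False (name t i a) [Var w]"
      by blast
    then have "w \<in> vars_literal L" by (simp add: vars_literal_def)
    with L G(2) v have "w = v" by blast
    with w show ?thesis by blast
  qed
  define S where "S = {(t, i, a) \<in> A. Literal False (name t i a) [Var v] \<in> H}"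
  have "H = hyp v S"
  proof (intro equalityI subsetI)
    fix L assume "L \<in> H"
    with lit' obtain t i a where "(t, i, a) \<in> S" "L = Literal False (name t i a) [Var v]"
      unfolding S_def by blast
    then show "L \<in> hyp v S"
      unfolding hyp_def by (intro image_eqI[of _ _ "(t, i, a)"]) auto
  qed (auto simp: hyp_def S_def)
  moreover have "S \<noteq> {}" using G(1) \<open>H = hyp v S\<close> by (auto simp: hyp_def)
  ultimately show thesis using that[of v S] by (auto simp: S_def)
qed

lemma unary_iff:
  assumes "S \<noteq> {}" "S \<subseteq> grid R W (length ts)"
  shows "(\<forall>e\<in>unary R W ts P t i. subsumes (hyp v S) e) \<longleftrightarrow>
    (\<forall>a. (t, i, a) \<in> S \<longrightarrow> P (ts ! a))"
proof -
  have *: "subsumes (hyp v S) (nogood R W (length ts) p p) \<longleftrightarrow> p \<notin> S" for p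
    unfolding nogood_def using assms by (subst subsumes_hyp_iff) auto
  have "a < length ts" if "(t, i, a) \<in> S" for t i a
    using assms(2) that by (auto simp: grid_def)
  with * show ?thesis unfolding unary_def by blast
qed

lemma binary_iff:
  assumes "S \<noteq> {}" "S \<subseteq> grid R W (length ts)"
  shows "(\<forall>e\<in>binary R W ts P t i t' i'. subsumes (hyp v S) e) \<longleftrightarrow>
    (\<forall>a b. (t, i, a) \<in> S \<longrightarrow> (t', i', b) \<in> S \<longrightarrow> P (ts ! a) (ts ! b))"
proof -
  have *: "subsumes (hyp v S) (nogood R W (length ts) p q) \<longleftrightarrow> p \<notin> S \<or> q \<notin> S" for p q
    unfolding nogood_def using assms by (subst subsumes_hyp_iff) auto
  have "a < length ts" if "(t, i, a) \<in> S" for t i a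
    using assms(2) that by (auto simp: grid_def)
  with * show ?thesis unfolding binary_def by blast
qed

lemma negatives_iff:
  assumes "S \<noteq> {}" "S \<subseteq> grid (Suc T) (T + length x + Suc T) (length ts)"
  shows "(\<forall>e\<in>negatives ts T x. \<not> subsumes (hyp v S) e) \<longleftrightarrow>
    (\<forall>t\<le>T. \<forall>i<T + length x + Suc T. \<exists>a. (t, i, a) \<in> S)"
proof -
  have "subsumes (hyp v S) (atom [False] ` (grid (Suc T) (T + length x + Suc T) (length ts) - {t} \<times> {i} \<times> UNIV))
    \<longleftrightarrow> (\<forall>a. (t, i, a) \<notin> S)" for t i
    using assms by (subst subsumes_hyp_single_iff) auto
  then show ?thesis by (auto simp: negatives_def Let_def less_Suc_eq_le)
qed

text \<open>Unlike in \<open>tableau\<close>, the neighbouring indices are not tested against the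
  bounds: for \<open>S\<close> inside the grid, a cell beyond the border holds no tile and the
  constraint is vacuous.\<close>

definition consistent_with :: "nat \<Rightarrow> tile list \<Rightarrow> nat \<Rightarrow> bool list \<Rightarrow> (nat \<times> nat \<times> nat) set \<Rightarrow> bool" where
  "consistent_with k ts T x S \<longleftrightarrow> (let R = Suc T; W = T + length x + R in
     (\<forall>t<R. \<forall>i<W. (\<forall>a. (t, i, a) \<in> S \<longrightarrow> (center (ts ! a) \<longleftrightarrow> i = T)) \<and>
       (\<forall>a b. (t, i, a) \<in> S \<longrightarrow> (t, Suc i, b) \<in> S \<longrightarrow> ctrl (ts ! a) = ctrl (ts ! b)) \<and>
       (\<forall>a b. (t, i, a) \<in> S \<longrightarrow> (Suc t, i, b) \<in> S \<longrightarrow> vert k 0 (ts ! a) (ts ! b)) \<and>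
       (\<forall>a b. (t, Suc i, a) \<in> S \<longrightarrow> (Suc t, i, b) \<in> S \<longrightarrow> vert k 1 (ts ! a) (ts ! b)) \<and>
       (\<forall>a b. (t, i, a) \<in> S \<longrightarrow> (Suc t, Suc i, b) \<in> S \<longrightarrow> vert k (-1) (ts ! a) (ts ! b))) \<and>
     (\<forall>i<W. (\<forall>a. (T, i, a) \<in> S \<longrightarrow> ctrl (ts ! a) = None) \<and>
       (\<forall>a. (0, i, a) \<in> S \<longrightarrow> initial k (word_on_tape x (int i - int T)) (ts ! a))))"

lemma positives_iff:
  assumes "S \<noteq> {}" "S \<subseteq> grid (Suc T) (T + length x + Suc T) (length ts)"
  shows "(\<forall>e\<in>positives k ts T x. subsumes (hyp v S) e) \<longleftrightarrow> consistent_with k ts T x S"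
  using assms unfolding positives_def consistent_with_def Let_def
  by (simp only: ball_Un ball_simps UN_ball_bex_simps subsumes_hyp_single_iff[OF assms(1)] Ball_def[of "{..<_}"]
      lessThan_iff unary_iff binary_iff simp_thms conj_assoc)

lemma tableau_imp_consistent_with:
  assumes "tableau k \<Delta> T x g" "set ts = tiles k \<Delta>"
  obtains S where "S \<noteq> {}" "S \<subseteq> grid (Suc T) (T + length x + Suc T) (length ts)"
    "consistent_with k ts T x S" "\<forall>t\<le>T. \<forall>i<T + length x + Suc T. \<exists>a. (t, i, a) \<in> S"
proof -
  let ?W = "T + length x + Suc T"
  have "\<exists>a<length ts. ts ! a = g t i" if "t \<le> T" "i < ?W" for t i
    using assms that unfolding tableau_def by (metis in_set_conv_nth)
  then obtain \<alpha> where \<alpha>: "\<And>t i. t \<le> T \<Longrightarrow> i < ?W \<Longrightarrow> \<alpha> t i < length ts"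
    "\<And>t i. t \<le> T \<Longrightarrow> i < ?W \<Longrightarrow> ts ! \<alpha> t i = g t i"
    by metis
  define S where "S = {(t, i, \<alpha> t i) | t i. t \<le> T \<and> i < ?W}"
  have S: "(t, i, a) \<in> S \<longleftrightarrow> t \<le> T \<and> i < ?W \<and> a = \<alpha> t i" for t i a
    by (auto simp: S_def)
  show thesis
  proof (rule that)
    show "S \<noteq> {}" using S[of 0 0] by auto
    show "S \<subseteq> grid (Suc T) ?W (length ts)" using \<alpha>(1) by (auto simp: S grid_def)
    show "\<forall>t\<le>T. \<forall>i<?W. \<exists>a. (t, i, a) \<in> S" by (simp add: S)
    show "consistent_with k ts T x S"
      using assms(1) \<alpha>(2) unfolding consistent_with_def tableau_def Let_def S
      by (auto simp: less_Suc_eq_le)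
  qed
qed

text \<open>A cell may hold several tiles of \<open>S\<close>, but the constraints concern all of
  them, so an arbitrary choice of one tile per cell is a tableau.\<close>

lemma consistent_with_imp_tableau:
  assumes "S \<subseteq> grid (Suc T) (T + length x + Suc T) (length ts)" "set ts = tiles k \<Delta>"
    and "consistent_with k ts T x S" "\<forall>t\<le>T. \<forall>i<T + length x + Suc T. \<exists>a. (t, i, a) \<in> S"
  shows "\<exists>g. tableau k \<Delta> T x g"
proof -
  obtain \<alpha> where \<alpha>: "\<And>t i. t \<le> T \<Longrightarrow> i < T + length x + Suc T \<Longrightarrow> (t, i, \<alpha> t i) \<in> S"
    using assms(4) by metis
  define g where "g t i = ts ! \<alpha> t i" for t i
  have "g t i \<in> tiles k \<Delta>" if "t \<le> T" "i < T + length x + Suc T" for t i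
    using \<alpha>[OF that] assms(1,2) unfolding g_def grid_def by (auto dest: nth_mem)
  then have "tableau k \<Delta> T x g"
    using assms(3) \<alpha> unfolding tableau_def consistent_with_def Let_def g_def less_Suc_eq_le
    by (auto simp: less_Suc_eq_le)
  then show ?thesis by blast
qed

section \<open>The restrictions on clauses, and NP-hardness\<close>

lemma atoms_properties:
  assumes "e \<subseteq> (\<Union>c. range (atom c))"
  shows "ground e" "horn e" "arity_at_most_2 e" "at_most_2_vars e" "no_repeated_terms e"
proof -
  have e: "\<exists>n c. L = Literal False n [Fun c []]" if "L \<in> e" for L
    using assms that by (auto simp: atom_def)
  have "vars_clause e = {}"
    unfolding vars_clause_def vars_literal_def using e by fastforce
  then show "ground e" "at_most_2_vars e" by (simp_all add: ground_def at_most_2_vars_def)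
  have "{L \<in> e. positive L} = {}" using e by fastforce
  then show "horn e" by (simp only: horn_def card.empty)
  show "arity_at_most_2 e" "no_repeated_terms e"
    unfolding arity_at_most_2_def no_repeated_terms_def using e by fastforce+
qed

lemma hyp_properties:
  assumes "S \<noteq> {}" "finite S"
  shows "hyp v S \<in> guarded_clauses" "consistent {hyp v S}" "horn (hyp v S)"
    "arity_at_most_2 (hyp v S)" "at_most_2_vars (hyp v S)" "no_repeated_terms (hyp v S)"
proof -
  have lit: "\<exists>n. L = Literal False n [Var v]" if "L \<in> hyp v S" for L
    using that by (auto simp: hyp_def)
  then have vars: "vars_literal L = {v}" if "L \<in> hyp v S" for L
    using that by (fastforce simp: vars_literal_def)
  obtain L where L: "L \<in> hyp v S" using assms(1) by (auto simp: hyp_def)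
  have "guarded (hyp v S)" unfolding guarded_def using L vars by (intro bexI[of _ L]) auto
  moreover have "function_free (hyp v S)" unfolding function_free_def using lit by fastforce
  ultimately show "hyp v S \<in> guarded_clauses"
    using assms(2) by (simp add: guarded_clauses_def hyp_def)
  have "vars_clause (hyp v S) \<subseteq> {v}" unfolding vars_clause_def using vars by auto
  then show "at_most_2_vars (hyp v S)"
    using card_mono[of "{v}" "vars_clause (hyp v S)"] by (simp add: at_most_2_vars_def)
  \<comment> \<open>Empty predicates are a model, since every literal is negative.\<close>
  have "holds_literal F (\<lambda>_ _. False) \<sigma> L" for F \<sigma> using lit[OF L] by (auto simp: holds_literal_def)
  with L show "consistent {hyp v S}" unfolding consistent_def by blast
  have "{L \<in> hyp v S. positive L} = {}" using lit by fastforce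
  then show "horn (hyp v S)" by (simp only: horn_def card.empty)
  show "arity_at_most_2 (hyp v S)" "no_repeated_terms (hyp v S)"
    unfolding arity_at_most_2_def no_repeated_terms_def using lit by fastforce+
qed

text \<open>\<open>R\<close> enters only where a solution is built from a tableau, and that solution
  has all four properties at once.\<close>

lemma solvable_iff_tableau:
  assumes R: "R \<subseteq> {horn, arity_at_most_2, at_most_2_vars, no_repeated_terms}"
    and ts: "set ts = tiles k \<Delta>"
  shows "(\<exists>H\<in>{H \<in> guarded_clauses. \<forall>P\<in>R. P H}. ilp_solution H (positives k ts T x) (negatives ts T x))
    \<longleftrightarrow> (\<exists>g. tableau k \<Delta> T x g)"
proof
  assume "\<exists>g. tableau k \<Delta> T x g"
  then obtain S where S: "S \<noteq> {}" "S \<subseteq> grid (Suc T) (T + length x + Suc T) (length ts)"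
    "consistent_with k ts T x S" "\<forall>t\<le>T. \<forall>i<T + length x + Suc T. \<exists>a. (t, i, a) \<in> S"
    using tableau_imp_consistent_with[OF _ ts] by blast
  moreover have "finite S" using S(2) by (rule finite_subset) (simp add: grid_def)
  moreover note hyp_properties[OF S(1) this, of "[]"]
  ultimately have "ilp_solution (hyp [] S) (positives k ts T x) (negatives ts T x)"
    "hyp [] S \<in> {H \<in> guarded_clauses. \<forall>P\<in>R. P H}"
    using R by (auto simp: ilp_solution_def positives_iff negatives_iff)
  then show "\<exists>H\<in>{H \<in> guarded_clauses. \<forall>P\<in>R. P H}.
      ilp_solution H (positives k ts T x) (negatives ts T x)" by blast
next
  let ?A = "grid (Suc T) (T + length x + Suc T) (length ts)"
  assume "\<exists>H\<in>{H \<in> guarded_clauses. \<forall>P\<in>R. P H}. ilp_solution H (positives k ts T x) (negatives ts T x)"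
  then obtain H where H: "guarded H" "\<forall>e\<in>positives k ts T x. subsumes H e"
    "\<forall>e\<in>negatives ts T x. \<not> subsumes H e"
    by (auto simp: guarded_clauses_def ilp_solution_def)
  moreover have "atom [False] ` ?A \<in> positives k ts T x" "atom [True] ` ?A \<in> positives k ts T x"
    by (simp_all add: positives_def Let_def)
  ultimately obtain v S where S: "H = hyp v S" "S \<subseteq> ?A" "S \<noteq> {}"
    using guarded_hyp by (metis (no_types, lifting))
  with H(2,3) show "\<exists>g. tableau k \<Delta> T x g"
    using consistent_with_imp_tableau[OF S(2) ts] by (simp add: positives_iff negatives_iff)
qed

lemma examples_atoms:
  "e \<in> positives k ts T x \<union> negatives ts T x \<Longrightarrow> e \<subseteq> (\<Union>c. range (atom c))"
  by (auto simp: positives_def negatives_def unary_def binary_def nogood_def Let_def)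

text \<open>The examples do not depend on \<open>R\<close> and have all four properties, so the
  output word is a legal instance for every \<open>R\<close>. Injectivity of the encoding turns
  membership of this word into solvability of exactly these examples.\<close>

lemma NP_hard_restricted:
  assumes R: "R \<subseteq> {horn, arity_at_most_2, at_most_2_vars, no_repeated_terms}"
  shows "NP_hard (ilp_consistency {H \<in> guarded_clauses. \<forall>P\<in>R. P H} {e \<in> ground_clauses. \<forall>P\<in>R. P e})"
  unfolding NP_hard_def
proof
  let ?H = "{H \<in> guarded_clauses. \<forall>P\<in>R. P H}" and ?E = "{e \<in> ground_clauses. \<forall>P\<in>R. P e}"
  fix L assume "L \<in> NP"
  then obtain k \<Delta> and p :: "nat poly" where tm: "turing_machine k \<Delta>"
    and L: "\<And>x. x \<in> L \<longleftrightarrow> accepts_within k \<Delta> (poly p (length x)) x"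
    unfolding NP_def by blast
  have "finite (tiles k \<Delta>)" using tm by (simp add: turing_machine_def finite_tiles)
  then obtain ts where ts: "set ts = tiles k \<Delta>" using finite_list by blast
  define f where "f x = out (reduction_prog k ts p) x (\<lambda>_. 0)" for x
  have "polytime_computable f"
    using wf_reduction_prog polytime_computable_out unfolding f_def by blast
  moreover have "x \<in> L \<longleftrightarrow> f x \<in> ilp_consistency ?H ?E" for x
  proof -
    define T where "T = poly p (length x)"
    obtain Ps Ns where f: "f x = encode_instance (Ps, Ns)"
      and Ps: "set ` set Ps = positives k ts T x" and Ns: "set ` set Ns = negatives ts T x"
      unfolding f_def T_def by (rule out_reduction_prog)
    have "set e \<in> ?E" if "e \<in> set Ps \<union> set Ns" for e
    proof -
      have "set e \<in> positives k ts T x \<union> negatives ts T x"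
        using that Ps Ns by blast
      from atoms_properties[OF examples_atoms[OF this]] R show ?thesis
        by (auto simp: ground_clauses_def)
    qed
    then have "set ` set Ps \<subseteq> ?E" "set ` set Ns \<subseteq> ?E" by blast+
    then have "f x \<in> ilp_consistency ?H ?E \<longleftrightarrow>
        (\<exists>H\<in>?H. ilp_solution H (set ` set Ps) (set ` set Ns))"
      unfolding ilp_consistency_def f by (auto dest: injD[OF inj_encode_instance])
    also have "\<dots> \<longleftrightarrow> x \<in> L"
      unfolding Ps Ns solvable_iff_tableau[OF R ts] L accepts_within_iff_tableau[OF tm] T_def ..
    finally show ?thesis ..
  qed
  ultimately show "polytime_reducible L (ilp_consistency ?H ?E)"
    unfolding polytime_reducible_def by blast
qed

theorem theorem2:
  "NP_hard (ilp_consistency guarded_clauses ground_clauses) \<and>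
   (\<forall>R \<subseteq> {horn, arity_at_most_2, at_most_2_vars, no_repeated_terms}.
      NP_hard (ilp_consistency
        {H \<in> guarded_clauses. \<forall>P \<in> R. P H}
        {e \<in> ground_clauses. \<forall>P \<in> R. P e}))"
  using NP_hard_restricted NP_hard_restricted[of "{}"] by simp


end
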